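(* Let $n\ge6$ be an integer, $a\in(0;1)$ and $t=a^2-a$. Then $$ \begin{aligned} A^2_{n,5}(a)=\frac{-t^{2n-11}}{((n-3)!)^2(2n-11)}\Bigl[&16(2n-1)(2n-3)^2(2n-5)^2(2n-11)t^5+80(n-1)(n-3)(2n-3)(2n-5)^2(2n-11)t^4\\ &+40(n-2)(n-3)(2n-3)(2n-5)(2n-7)(2n-11)t^3+40(n-2)(n-3)^2(n-4)(2n-5)(2n-11)t^2\\ &+5(n-3)^2(n-4)^2(2n-5)(2n-11)t+(n-3)^2(n-4)^2(n-5)^2\Bigr]. \end{aligned} $$
   Context: For integers $n\ge1$, $0\le k\le n-1$ and $a\in(0;1)$, $A_{n,k}(a):=\sup\{|f^{(k)}(a)| : f\in \mathring{W}_2^n[0;1],\ \int_0^1|f^{(n)}(x)|^2dx\le 1\}$ and $A^2_{n,k}(a)=(A_{n,k}(a))^2$. Here $\mathring{W}_2^n[0;1]$ is the space of functions $f$ on $[0;1]$ whose derivatives up to order $n-1$ are absolutely continuous, with $f^{(n)}\in L_2[0;1]$ and $f^{(j)}(0)=f^{(j)}(1)=0$ for $j=0,\dots,n-1$. *)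

theory Defs
  imports "HOL-Analysis.Analysis"
begin

text \<open>
  The epsilon-delta definition of an absolutely continuous function. An element \<open>k\<close> of \<open>d\<close> is a
  nonempty compact interval with endpoints \<open>Inf k\<close> and \<open>Sup k\<close>; distinct elements have disjoint
  interiors. (The library's \<open>absolutely_continuous\<close> is the relation between measures.)
\<close>

definition absolutely_continuous_on :: "real set \<Rightarrow> (real \<Rightarrow> real) \<Rightarrow> bool" where
  "absolutely_continuous_on S f \<longleftrightarrow>
     (\<forall>\<epsilon>>0. \<exists>\<delta>>0. \<forall>d T. d division_of T \<longrightarrow> T \<subseteq> S \<longrightarrow> (\<Sum>k\<in>d. Sup k - Inf k) < \<delta> \<longrightarrow>
        (\<Sum>k\<in>d. \<bar>f (Sup k) - f (Inf k)\<bar>) < \<epsilon>)"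

text \<open>
  Iterated derivative of a function on \<open>[0;1]\<close>, one-sided at the endpoints. Its value is
  unspecified wherever the derivative does not exist.
\<close>

primrec deriv01 :: "nat \<Rightarrow> (real \<Rightarrow> real) \<Rightarrow> real \<Rightarrow> real" where
  "deriv01 0 f = f"
| "deriv01 (Suc j) f = (\<lambda>x. vector_derivative (deriv01 j f) (at x within {0..1}))"

definition L2_01 :: "(real \<Rightarrow> real) set" where
  "L2_01 = {g. set_borel_measurable lebesgue {0..1} g \<and>
               set_integrable lebesgue {0..1} (\<lambda>x. \<bar>g x\<bar>\<^sup>2)}"

text \<open>
  Functions are total, but only the values on \<open>[0;1]\<close> matter. The derivatives up to order \<open>n - 1\<close>
  exist everywhere on \<open>[0;1]\<close>; the \<open>n\<close>-th one is defined almost everywhere (which already follows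
  from absolute continuity, by Lebesgue's theorem), so that its unspecified values elsewhere do
  not affect the integrals.
\<close>

definition W2_ring :: "nat \<Rightarrow> (real \<Rightarrow> real) set" where
  "W2_ring n = {f.
     (\<forall>j. Suc j < n \<longrightarrow> deriv01 j f differentiable_on {0..1}) \<and>
     (\<forall>j<n. absolutely_continuous_on {0..1} (deriv01 j f)) \<and>
     (AE x in lebesgue. x \<in> {0..1} \<longrightarrow> deriv01 (n - 1) f differentiable (at x within {0..1})) \<and>
     deriv01 n f \<in> L2_01 \<and>
     (\<forall>j<n. deriv01 j f 0 = 0 \<and> deriv01 j f 1 = 0)}"

text \<open>The supremum is taken in \<^typ>\<open>ereal\<close>, so that it is meaningful without a boundedness proof.\<close>

definition A_sup :: "nat \<Rightarrow> nat \<Rightarrow> real \<Rightarrow> ereal" where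
  "A_sup n k a = Sup {ereal \<bar>deriv01 k f a\<bar> | f.
     f \<in> W2_ring n \<and> (LINT x:{0..1}|lebesgue. \<bar>deriv01 n f x\<bar>\<^sup>2) \<le> 1}"

end

theory Submission
  imports Defs "HOL-Computational_Algebra.Polynomial"
begin

text \<open>
  The functional \<open>f \<mapsto> f\<^sup>(\<^sup>k\<^sup>)(a)\<close> is represented, for the inner product \<open>\<integral> f\<^sup>(\<^sup>n\<^sup>) g\<^sup>(\<^sup>n\<^sup>)\<close>, by a piecewise polynomial
  \<open>g\<close> of degree at most \<open>2n - 1\<close> with a single knot at \<open>a\<close>, so that \<open>A\<^sup>2\<^sub>n\<^sub>,\<^sub>k(a) = g\<^sup>(\<^sup>k\<^sup>)(a)\<close>. For \<open>k = 0\<close> the spline is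
  explicit; integrating it and subtracting a multiple of the primitive of \<open>(x\<^sup>2 - x)\<^sup>n\<close> turns the spline for \<open>(n, k)\<close>
  into the one for \<open>(n + 1, k + 1)\<close>. (Equivalently, by Rodrigues' formula, one projects off the next Legendre
  polynomial.) Hence
    \<open>A\<^sup>2\<^sub>n\<^sub>+\<^sub>1\<^sub>,\<^sub>k\<^sub>+\<^sub>1(a) = A\<^sup>2\<^sub>n\<^sub>,\<^sub>k(a) - (2n + 1) / (n!)\<^sup>2 (D\<^sup>k (x\<^sup>2 - x)\<^sup>n (a))\<^sup>2\<close>,
  and five steps from \<open>(n - 5, 0)\<close> lead to \<open>(n, 5)\<close>.
\<close>

subsection \<open>Absolutely continuous functions\<close>

text \<open>
  The gauge confines the intervals tagged in the exceptional null set to an open set of small measure,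
  where absolute continuity bounds the increments of \<open>F\<close>.
\<close>

lemma has_integral_absolutely_continuous_on:
  fixes F g :: "real \<Rightarrow> real"
  assumes ac: "absolutely_continuous_on S F" and sub: "{c..d} \<subseteq> S" and cd: "c \<le> d"
    and N: "negligible N"
    and der: "\<And>x. x \<in> {c..d} - N \<Longrightarrow> (F has_vector_derivative g x) (at x within {c..d})"
  shows "(g has_integral (F d - F c)) {c..d}"
proof -
  \<comment> \<open>With the integrand set to zero on \<open>N\<close>, an interval tagged in
    \<open>N\<close> contributes to the error only its increment of \<open>F\<close>. The final
    spike restores \<open>g\<close>.\<close>
  define h where "h x = (if x \<in> N then 0 else g x)" for x
  have "(h has_integral (F d - F c)) {c..d}"
    unfolding has_integral_real
  proof (intro allI impI)
    fix e :: real
    assume "e > 0"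
    \<comment> \<open>The \<open>+ 1\<close> keeps the quotient defined when \<open>c = d\<close>.
      The other half of \<open>e\<close> is reserved for the intervals tagged in
      \<open>N\<close>.\<close>
    define \<epsilon> where "\<epsilon> = e / (2 * (d - c + 1))"
    have "\<epsilon> > 0" using \<open>e > 0\<close> cd by (simp add: \<epsilon>_def)
    have \<epsilon>le: "\<epsilon> * (d - c) < e / 2" 
      using \<open>e > 0\<close> cd by (simp add: \<epsilon>_def field_simps)
    have "\<forall>x. \<exists>r>0. x \<in> {c..d} - N \<longrightarrow>
         (\<forall>y\<in>{c..d}. norm (y-x) < r \<longrightarrow> norm (F y - F x - (y-x) *\<^sub>R g x) \<le> \<epsilon> * norm (y-x))"
      using der[unfolded has_vector_derivative_def has_derivative_within_alt] \<open>\<epsilon> > 0\<close>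
      by blast
    then obtain r where r: "\<And>x. 0 < r x"
      "\<And>x y. \<lbrakk>x \<in> {c..d} - N; y \<in> {c..d}; norm (y-x) < r x\<rbrakk>
           \<Longrightarrow> norm (F y - F x - (y-x) *\<^sub>R g x) \<le> \<epsilon> * norm (y-x)"
      by metis
    obtain \<delta> where "\<delta> > 0" and \<delta>: "\<And>\<D> T. \<D> division_of T \<Longrightarrow> T \<subseteq> S \<Longrightarrow>
        (\<Sum>k\<in>\<D>. Sup k - Inf k) < \<delta> \<Longrightarrow> (\<Sum>k\<in>\<D>. \<bar>F (Sup k) - F (Inf k)\<bar>) < e / 2"
      using ac \<open>e > 0\<close> unfolding absolutely_continuous_on_def by (meson half_gt_zero)
    obtain U where U: "open U" "N \<subseteq> U" "U - N \<in> lmeasurable" "emeasure lebesgue (U - N) < ennreal \<delta>"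
      using sets_lebesgue_outer_open[of N \<delta>] negligible_imp_sets[OF N] \<open>\<delta> > 0\<close> by blast
    have Um: "U \<in> lmeasurable"
      using U(2,3) N by (metis Diff_partition fmeasurable.Un negligible_imp_measurable)
    have "measure lebesgue U = measure lebesgue (U - N)"
      by (rule measure_negligible_symdiff[OF U(3)]) (auto intro: negligible_subset[OF N])
    also have "\<dots> < \<delta>"
      using U(3,4) \<open>\<delta> > 0\<close> by (metis emeasure_eq_measure2 ennreal_less_iff measure_nonneg)
    finally have U\<delta>: "measure lebesgue U < \<delta>" .
    define \<gamma> where "\<gamma> x = (if x \<in> N then U else ball x (r x))" for x
    have "gauge \<gamma>"
      unfolding gauge_def \<gamma>_def using U r(1) by auto
    moreover have "norm ((\<Sum>(x,K)\<in>p. measure lborel K *\<^sub>R h x) - (F d - F c)) < e"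
      if p: "p tagged_division_of {c..d}" and fine: "\<gamma> fine p" for p
    proof -
      have finp: "finite p" using p by blast
      have pK: "\<exists>u v. K = {u..v} \<and> u \<le> x \<and> x \<le> v \<and> c \<le> u \<and> v \<le> d" if xK: "(x, K) \<in> p" for x K
      proof -
        obtain u v where "K = cbox u v" using tagged_division_ofD(4)[OF p xK] by blast
        moreover have "x \<in> K" "K \<subseteq> {c..d}" using tagged_division_ofD(2,3)[OF p xK] by auto
        ultimately show ?thesis by (intro exI[of _ u] exI[of _ v]) auto
      qed
      define q where "q = {z \<in> p. fst z \<in> N}"
      define w where "w = (\<lambda>(x,K). measure lborel K *\<^sub>R h x - (F (Sup K) - F (Inf K)))"
      have dc: "d - c = (\<Sum>(x,K)\<in>p. Sup K - Inf K)" and Fdc: "F d - F c = (\<Sum>(x,K)\<in>p. F (Sup K) - F (Inf K))"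
        using additive_tagged_division_1[where f= "\<lambda>x. x"] additive_tagged_division_1[where f= F]
            cd p by auto
      have "(\<Sum>(x,K)\<in>p. measure lborel K *\<^sub>R h x) - (F d - F c) = (\<Sum>z\<in>p. w z)"
        unfolding Fdc sum_subtractf[symmetric] w_def by (intro sum.cong) auto
      also have "\<dots> = (\<Sum>z\<in>p - q. w z) + (\<Sum>z\<in>q. w z)"
        using finp by (subst sum.subset_diff[of q p]) (auto simp: q_def)
      finally have split: "(\<Sum>(x,K)\<in>p. measure lborel K *\<^sub>R h x) - (F d - F c) = (\<Sum>z\<in>p - q. w z) + (\<Sum>z\<in>q. w z)" .
      have "norm (\<Sum>z\<in>p - q. w z) \<le> (\<Sum>z\<in>p - q. \<epsilon> * (case z of (x,K) \<Rightarrow> Sup K - Inf K))"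
      proof (rule sum_norm_le, safe)
        fix x K assume xK: "(x, K) \<in> p" and nq: "(x, K) \<notin> q"
        obtain u v where K: "K = {u..v}" "u \<le> x" "x \<le> v" "c \<le> u" "v \<le> d" using pK[OF xK] by blast
        have xN: "x \<notin> N" using xK nq by (auto simp: q_def)
        have Kr: "K \<subseteq> ball x (r x)" using fine xK xN by (force simp: fine_def \<gamma>_def)
        have fu: "norm (F u - F x - (u - x) *\<^sub>R g x) \<le> \<epsilon> * norm (u - x)"
          by (rule r(2)) (use K Kr xN in \<open>auto simp: dist_real_def subset_iff\<close>)
        have fv: "norm (F v - F x - (v - x) *\<^sub>R g x) \<le> \<epsilon> * norm (v - x)"
        proof (rule r(2))
          show "norm (v - x) < r x"
            using subsetD[OF Kr, of v] K by (simp add: dist_real_def)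
        qed (use K xN in auto)
        \<comment> \<open>The increment over \<open>K\<close> is split at the tag. Since
          \<open>u \<le> x \<le> v\<close>, the two linearisation errors together are at most
          \<open>\<epsilon>\<close> times the length of \<open>K\<close>.\<close>
        have "w (x, K) = (F u - F x - (u - x) *\<^sub>R g x) - (F v - F x - (v - x) *\<^sub>R g x)"
          using K xN by (simp add: w_def h_def algebra_simps)
        then have "norm (w (x, K)) \<le> \<epsilon> * norm (u - x) + \<epsilon> * norm (v - x)"
          using order_trans[OF norm_triangle_ineq4 add_mono[OF fu fv]] by simp
        then show "norm (w (x, K)) \<le> \<epsilon> * (Sup K - Inf K)"
          using K by (simp add: algebra_simps)
      qed
      also have "\<dots> \<le> (\<Sum>z\<in>p. \<epsilon> * (case z of (x,K) \<Rightarrow> Sup K - Inf K))"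
        by (rule sum_mono2) (use finp \<open>\<epsilon> > 0\<close> in \<open>force dest: pK\<close>)+
      also have "\<dots> = \<epsilon> * (d - c)"
        by (simp add: dc sum_distrib_left)
      also have "\<dots> < e / 2" by fact
      finally have 1: "norm (\<Sum>z\<in>p - q. w z) < e / 2" .
      have q: "q tagged_division_of \<Union>(snd ` q)"
        by (rule tagged_partial_division_of_Union_self)
           (use p in \<open>auto simp: q_def tagged_division_of_def intro: tagged_partial_division_subset\<close>)
      have qdiv: "snd ` q division_of \<Union>(snd ` q)"
        using division_of_tagged_division[OF q] .
      have len: "measure lebesgue K = Sup K - Inf K" if "K \<in> snd ` q" for K
        using that pK by (force simp: q_def)
      have "(\<Sum>K\<in>snd ` q. Sup K - Inf K) = measure lebesgue (\<Union>(snd ` q))"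
        using content_division[OF qdiv] len by simp
      also have "\<dots> \<le> measure lebesgue U"
      proof (rule measure_mono_fmeasurable)
        show "\<Union>(snd ` q) \<subseteq> U"
          using fine by (force simp: q_def fine_def \<gamma>_def)
        show "\<Union>(snd ` q) \<in> sets lebesgue"
          using lmeasurable_division[OF qdiv] by auto
      qed fact
      finally have "(\<Sum>K\<in>snd ` q. \<bar>F (Sup K) - F (Inf K)\<bar>) < e / 2"
      proof (intro \<delta>[OF qdiv])
        show "\<Union>(snd ` q) \<subseteq> S"
          using tagged_division_ofD(3)[OF p] sub by (fastforce simp: q_def)
      qed (use U\<delta> in linarith)
      moreover have "(\<Sum>(x,K)\<in>q. \<bar>F (Sup K) - F (Inf K)\<bar>) = (\<Sum>K\<in>snd ` q. \<bar>F (Sup K) - F (Inf K)\<bar>)"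
      proof -
        \<comment> \<open>Distinct tagged pairs can share an interval only if it is degenerate, and
          there the increment is zero, so summing over the distinct intervals loses nothing. The
          empty box counts as degenerate too, while \<open>Sup {}\<close> is unspecified; hence the
          explicit 0.\<close>
        define \<phi> where "\<phi> K = (if K = {} then 0 else \<bar>F (Sup K) - F (Inf K)\<bar>)" for K
        have \<phi>: "\<bar>F (Sup K) - F (Inf K)\<bar> = \<phi> K" if "(x, K) \<in> q" for x K
          using pK[of x K] that by (auto simp: q_def \<phi>_def)
        have "(\<Sum>(x,K)\<in>q. \<phi> K) = (\<Sum>K\<in>snd ` q. \<phi> K)"
        proof (rule sum.over_tagged_division_lemma[OF q])
          fix u v :: real assume "box u v = {}"
          then show "\<phi> (cbox u v) = 0"
            by (cases "u = v") (auto simp: \<phi>_def)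
        qed
        moreover have "(\<Sum>(x,K)\<in>q. \<bar>F (Sup K) - F (Inf K)\<bar>) = (\<Sum>(x,K)\<in>q. \<phi> K)"
          by (rule sum.cong) (auto simp: \<phi>)
        moreover have "(\<Sum>K\<in>snd ` q. \<bar>F (Sup K) - F (Inf K)\<bar>) = (\<Sum>K\<in>snd ` q. \<phi> K)"
          by (rule sum.cong) (auto simp: \<phi>)
        ultimately show ?thesis by simp
      qed
      moreover have "norm (\<Sum>z\<in>q. w z) \<le> (\<Sum>z\<in>q. case z of (x,K) \<Rightarrow> \<bar>F (Sup K) - F (Inf K)\<bar>)"
        by (rule sum_norm_le) (auto simp: q_def w_def h_def)
      ultimately have 2: "norm (\<Sum>z\<in>q. w z) < e / 2" by simp
      show ?thesis unfolding split using 1 2 by (simp only: real_norm_def)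
    qed
    ultimately show "\<exists>\<gamma>. gauge \<gamma> \<and> (\<forall>p. p tagged_division_of {c..d} \<and> \<gamma> fine p \<longrightarrow>
        norm ((\<Sum>(x,K)\<in>p. measure lborel K *\<^sub>R h x) - (F d - F c)) < e)"
      by (intro exI[of _ \<gamma>]) simp
  qed
  then show ?thesis
    by (rule has_integral_spike[OF N, rotated]) (auto simp: h_def)
qed

section \<open>Permanence properties of absolute continuity\<close>

lemma absolutely_continuous_onE:
  assumes "absolutely_continuous_on S f" "\<epsilon> > 0"
  obtains \<delta> where "\<delta> > 0"
    "\<And>d T. d division_of T \<Longrightarrow> T \<subseteq> S \<Longrightarrow> (\<Sum>k\<in>d. Sup k - Inf k) < \<delta> \<Longrightarrow>
      (\<Sum>k\<in>d. \<bar>f (Sup k) - f (Inf k)\<bar>) < \<epsilon>"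
  using assms unfolding absolutely_continuous_on_def by meson

lemma division_of_memE_real:
  fixes T :: "real set"
  assumes "d division_of T" "k \<in> d"
  obtains u v where "u \<le> v" "k = {u..v}" "Inf k = u" "Sup k = v" "u \<in> T" "v \<in> T"
proof -
  obtain u v where "k = cbox u v" "k \<noteq> {}" "k \<subseteq> T"
    using division_ofD(2,3,4)[OF assms] by blast
  then show thesis by (intro that[of u v]) auto
qed

lemma continuous_on_absolutely_continuous_on:
  fixes c d :: real
  assumes "absolutely_continuous_on {c..d} f"
  shows "continuous_on {c..d} f"
  unfolding continuous_on_iff
proof (intro ballI allI impI)
  fix x e :: real assume x: "x \<in> {c..d}" and "e > 0"
  obtain \<delta> where \<delta>: "\<delta> > 0" "\<And>D T. D division_of T \<Longrightarrow> T \<subseteq> {c..d} \<Longrightarrow> (\<Sum>k\<in>D. Sup k - Inf k) < \<delta> \<Longrightarrow>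
      (\<Sum>k\<in>D. \<bar>f (Sup k) - f (Inf k)\<bar>) < e"
    by (rule absolutely_continuous_onE[OF assms \<open>e > 0\<close>]) (rule that)
  have *: "\<bar>f v - f u\<bar> < e" if "u \<le> v" "u \<in> {c..d}" "v \<in> {c..d}" "v - u < \<delta>" for u v
  proof -
    have "{cbox u v} division_of cbox u v"
      using that by (intro division_of_self) auto
    from \<delta>(2)[OF this] show ?thesis using that by auto
  qed
  show "\<exists>\<delta>>0. \<forall>y\<in>{c..d}. dist y x < \<delta> \<longrightarrow> dist (f y) (f x) < e"
  proof (intro exI[of _ \<delta>] conjI ballI impI)
    fix y assume "y \<in> {c..d}" "dist y x < \<delta>"
    then show "dist (f y) (f x) < e"
      using *[of x y] *[of y x] x by (cases "x \<le> y") (auto simp: dist_real_def abs_minus_commute)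
  qed fact
qed

lemma absolutely_continuous_on_lipschitz:
  assumes "\<And>x y. x \<in> S \<Longrightarrow> y \<in> S \<Longrightarrow> x \<le> y \<Longrightarrow> \<bar>f y - f x\<bar> \<le> K * (y - x)"
  shows "absolutely_continuous_on S f"
  unfolding absolutely_continuous_on_def
proof (intro allI impI)
  fix \<epsilon> :: real assume "\<epsilon> > 0"
  show "\<exists>\<delta>>0. \<forall>d T. d division_of T \<longrightarrow> T \<subseteq> S \<longrightarrow> (\<Sum>k\<in>d. Sup k - Inf k) < \<delta> \<longrightarrow>
        (\<Sum>k\<in>d. \<bar>f (Sup k) - f (Inf k)\<bar>) < \<epsilon>"
  \<comment> \<open>\<open>K\<close> may be zero or negative, so the denominator is a positive
    majorant of it.\<close>
  proof (intro exI[of _ "\<epsilon> / (\<bar>K\<bar> + 1)"] conjI allI impI)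
    fix d T assume d: "d division_of T" "T \<subseteq> S" and len: "(\<Sum>k\<in>d. Sup k - Inf k) < \<epsilon> / (\<bar>K\<bar> + 1)"
    have "(\<Sum>k\<in>d. \<bar>f (Sup k) - f (Inf k)\<bar>) \<le> (\<Sum>k\<in>d. (\<bar>K\<bar> + 1) * (Sup k - Inf k))"
    proof (rule sum_mono)
      fix k assume "k \<in> d"
      then obtain u v where k: "u \<le> v" "Inf k = u" "Sup k = v" "u \<in> T" "v \<in> T"
        using division_of_memE_real[OF d(1)] by metis
      have "\<bar>f v - f u\<bar> \<le> K * (v - u)" using assms k d(2) by auto
      also have "\<dots> \<le> (\<bar>K\<bar> + 1) * (v - u)" by (rule mult_right_mono) (use k in auto)
      finally show "\<bar>f (Sup k) - f (Inf k)\<bar> \<le> (\<bar>K\<bar> + 1) * (Sup k - Inf k)" using k by simp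
    qed
    also have "\<dots> = (\<bar>K\<bar> + 1) * (\<Sum>k\<in>d. Sup k - Inf k)" by (simp add: sum_distrib_left)
    also have "\<dots> < \<epsilon>" using len by (simp add: field_simps)
    finally show "(\<Sum>k\<in>d. \<bar>f (Sup k) - f (Inf k)\<bar>) < \<epsilon>" .
  qed (use \<open>\<epsilon> > 0\<close> in auto)
qed

lemma absolutely_continuous_on_mult:
  fixes c d :: real
  assumes f: "absolutely_continuous_on {c..d} f" and g: "absolutely_continuous_on {c..d} g"
  shows "absolutely_continuous_on {c..d} (\<lambda>x. f x * g x)"
proof -
  have "\<exists>M>0. \<forall>x\<in>{c..d}. \<bar>h x\<bar> \<le> M" if "absolutely_continuous_on {c..d} h" for h
  proof -
    have "bounded (h ` {c..d})"
      using continuous_on_absolutely_continuous_on[OF that]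
      by (simp add: compact_imp_bounded compact_continuous_image)
    then show ?thesis unfolding bounded_pos by auto
  qed
  from this[OF f] this[OF g] obtain M M' where M: "M > 0" "\<And>x. x \<in> {c..d} \<Longrightarrow> \<bar>f x\<bar> \<le> M"
    and M': "M' > 0" "\<And>x. x \<in> {c..d} \<Longrightarrow> \<bar>g x\<bar> \<le> M'"
    by blast
  show ?thesis
    unfolding absolutely_continuous_on_def
  proof (intro allI impI)
    fix \<epsilon> :: real assume "\<epsilon> > 0"
    then have pos: "\<epsilon> / (2 * M') > 0" "\<epsilon> / (2 * M) > 0" using M M' by auto
    obtain \<delta> where \<delta>: "\<delta> > 0" "\<And>D T. D division_of T \<Longrightarrow> T \<subseteq> {c..d} \<Longrightarrow> (\<Sum>k\<in>D. Sup k - Inf k) < \<delta> \<Longrightarrow>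
      (\<Sum>k\<in>D. \<bar>f (Sup k) - f (Inf k)\<bar>) < \<epsilon> / (2 * M')"
      by (rule absolutely_continuous_onE[OF f pos(1)]) (rule that)
    obtain \<delta>' where \<delta>': "\<delta>' > 0" "\<And>D T. D division_of T \<Longrightarrow> T \<subseteq> {c..d} \<Longrightarrow> (\<Sum>k\<in>D. Sup k - Inf k) < \<delta>' \<Longrightarrow>
      (\<Sum>k\<in>D. \<bar>g (Sup k) - g (Inf k)\<bar>) < \<epsilon> / (2 * M)"
      by (rule absolutely_continuous_onE[OF g pos(2)]) (rule that)
    show "\<exists>\<delta>>0. \<forall>D T. D division_of T \<longrightarrow> T \<subseteq> {c..d} \<longrightarrow> (\<Sum>k\<in>D. Sup k - Inf k) < \<delta> \<longrightarrow>
        (\<Sum>k\<in>D. \<bar>f (Sup k) * g (Sup k) - f (Inf k) * g (Inf k)\<bar>) < \<epsilon>"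
    proof (intro exI[of _ "min \<delta> \<delta>'"] conjI allI impI)
      fix D T assume D: "D division_of T" "T \<subseteq> {c..d}" and len: "(\<Sum>k\<in>D. Sup k - Inf k) < min \<delta> \<delta>'"
      have "(\<Sum>k\<in>D. \<bar>f (Sup k) * g (Sup k) - f (Inf k) * g (Inf k)\<bar>)
        \<le> (\<Sum>k\<in>D. M' * \<bar>f (Sup k) - f (Inf k)\<bar> + M * \<bar>g (Sup k) - g (Inf k)\<bar>)"
      proof (rule sum_mono)
        fix k assume "k \<in> D"
        then obtain u v where k: "Inf k = u" "Sup k = v" "u \<in> T" "v \<in> T"
          using division_of_memE_real[OF D(1)] by metis
        have "\<bar>f v * g v - f u * g u\<bar> = \<bar>g v * (f v - f u) + f u * (g v - g u)\<bar>"
          by (simp add: algebra_simps)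
        also have "\<dots> \<le> \<bar>g v * (f v - f u)\<bar> + \<bar>f u * (g v - g u)\<bar>" by (rule abs_triangle_ineq)
        also have "\<dots> \<le> M' * \<bar>f v - f u\<bar> + M * \<bar>g v - g u\<bar>"
          unfolding abs_mult using k D(2) by (intro add_mono mult_right_mono M M') auto
        finally show "\<bar>f (Sup k) * g (Sup k) - f (Inf k) * g (Inf k)\<bar>
          \<le> M' * \<bar>f (Sup k) - f (Inf k)\<bar> + M * \<bar>g (Sup k) - g (Inf k)\<bar>" using k by simp
      qed
      also have "\<dots> = M' * (\<Sum>k\<in>D. \<bar>f (Sup k) - f (Inf k)\<bar>) + M * (\<Sum>k\<in>D. \<bar>g (Sup k) - g (Inf k)\<bar>)"
        by (simp add: sum.distrib sum_distrib_left)
      also have "\<dots> < \<epsilon> / 2 + \<epsilon> / 2"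
        using \<delta>(2)[OF D] \<delta>'(2)[OF D] len M M' by (intro add_strict_mono) (auto simp: field_simps)
      finally show "(\<Sum>k\<in>D. \<bar>f (Sup k) * g (Sup k) - f (Inf k) * g (Inf k)\<bar>) < \<epsilon>" by simp
    qed (use \<delta> \<delta>' in auto)
  qed
qed

lemma poly_lipschitz_on_Icc:
  fixes p :: "real poly"
  obtains K where "\<And>x y. c \<le> x \<Longrightarrow> x \<le> y \<Longrightarrow> y \<le> d \<Longrightarrow> \<bar>poly p y - poly p x\<bar> \<le> K * (y - x)"
proof -
  have "bounded (poly (pderiv p) ` {c..d})"
    by (intro compact_imp_bounded compact_continuous_image continuous_intros) auto
  then obtain K where K: "\<And>x. x \<in> {c..d} \<Longrightarrow> \<bar>poly (pderiv p) x\<bar> \<le> K"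
    unfolding bounded_iff by (metis image_eqI real_norm_def)
  have "\<bar>poly p y - poly p x\<bar> \<le> K * (y - x)" if "c \<le> x" "x \<le> y" "y \<le> d" for x y
  proof (cases "x = y")
    case False
    with that have "x < y" by simp
    then obtain z where "z > x" "z < y" "poly p y - poly p x = (y - x) * poly (pderiv p) z"
      using poly_MVT[of x y p] by blast
    then show ?thesis
      using K[of z] that by (simp add: abs_mult mult.commute mult_left_mono)
  qed simp
  then show thesis using that by blast
qed

lemma absolutely_continuous_on_poly: "absolutely_continuous_on {c..d} (poly p)"
  using poly_lipschitz_on_Icc[of c d p] absolutely_continuous_on_lipschitz[of "{c..d}" "poly p"]
  by (metis atLeastAtMost_iff)

section \<open>Integration by parts in \<open>W2_ring n\<close>\<close>

lemma has_vector_derivative_poly: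
  "(poly p has_vector_derivative poly (pderiv p) x) (at x within S)" for p :: "real poly"
  using poly_DERIV[of p x] by (simp add: has_real_derivative_iff_has_vector_derivative has_vector_derivative_at_within)

text \<open>Only the order \<open>n - 1\<close> can require a nonempty \<open>N\<close>. This brings
  all orders into the form taken by the fundamental theorem for absolutely continuous
  functions.\<close>

lemma W2_ring_has_vector_derivative:
  assumes "f \<in> W2_ring n" "j < n"
  obtains N where "negligible N"
    "\<And>x. x \<in> {0..1} - N \<Longrightarrow>
      (deriv01 j f has_vector_derivative deriv01 (Suc j) f x) (at x within {0..1})"
proof -
  have *: "(deriv01 j f has_vector_derivative deriv01 (Suc j) f x) (at x within {0..1})"
    if "deriv01 j f differentiable (at x within {0..1})" for x
    using that by (simp add: vector_derivative_works)
  show thesis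
  proof (cases "Suc j < n")
    case True
    then show ?thesis
      using assms * by (intro that[of "{}"]) (auto simp: W2_ring_def differentiable_on_def)
  next
    case False
    then have j: "j = n - 1" using assms by simp
    have "AE x in lebesgue. x \<in> {0..1} \<longrightarrow> deriv01 j f differentiable (at x within {0..1})"
      using assms unfolding W2_ring_def j by blast
    then obtain N where "N \<in> null_sets lebesgue"
      "{x \<in> space lebesgue. \<not> (x \<in> {0..1} \<longrightarrow> deriv01 j f differentiable (at x within {0..1}))} \<subseteq> N"
      by (rule AE_E3) auto
    then show ?thesis
      using * by (intro that[of N]) (auto simp: negligible_iff_null_sets)
  qed
qed

text \<open>Each integration by parts moves one derivative from \<open>f\<close> to \<open>q\<close>
  and changes the sign; after \<open>m\<close> of them the remaining integral contains the zero
  polynomial. The interval is free so that it can end at the knot of a spline.\<close>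

lemma W2_ring_by_parts:
  assumes f: "f \<in> W2_ring n" and cd: "0 \<le> c" "c \<le> d" "d \<le> 1"
  shows "m \<le> n \<Longrightarrow> (pderiv ^^ m) q = 0 \<Longrightarrow>
    ((\<lambda>x. poly q x * deriv01 m f x) has_integral
      (\<Sum>i<m. (- 1) ^ i * poly ((pderiv ^^ i) q) d * deriv01 (m - 1 - i) f d) -
      (\<Sum>i<m. (- 1) ^ i * poly ((pderiv ^^ i) q) c * deriv01 (m - 1 - i) f c)) {c..d}"
proof (induction m arbitrary: q)
  case 0
  then show ?case by simp
next
  case (Suc m)
  let ?B = "\<lambda>q m x. \<Sum>i<m. (- 1) ^ i * poly ((pderiv ^^ i) q) x * deriv01 (m - 1 - i) f x"
  \<comment> \<open>The term \<open>i = 0\<close> is the boundary term of the current step; the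
    others, reindexed, are minus the boundary form of \<open>pderiv q\<close>.\<close>
  have Suc_B: "?B q (Suc m) x = poly q x * deriv01 m f x - ?B (pderiv q) m x" for x
    by (subst sum.lessThan_Suc_shift) (simp add: funpow_Suc_right sum_negf del: funpow.simps)
  have IH: "((\<lambda>x. poly (pderiv q) x * deriv01 m f x) has_integral
      (?B (pderiv q) m d - ?B (pderiv q) m c)) {c..d}"
    using Suc by (intro Suc.IH) (simp_all add: funpow_Suc_right del: funpow.simps)
  obtain N where N: "negligible N" "\<And>x. x \<in> {0..1} - N \<Longrightarrow>
      (deriv01 m f has_vector_derivative deriv01 (Suc m) f x) (at x within {0..1})"
    using W2_ring_has_vector_derivative[OF f, of m] Suc.prems by auto
  have "((\<lambda>x. poly q x * deriv01 (Suc m) f x + poly (pderiv q) x * deriv01 m f x) has_integral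
      (poly q d * deriv01 m f d - poly q c * deriv01 m f c)) {c..d}"
  proof (rule has_integral_absolutely_continuous_on[OF _ _ cd(2) N(1)])
    show "absolutely_continuous_on {0..1} (\<lambda>x. poly q x * deriv01 m f x)"
      using f Suc.prems by (intro absolutely_continuous_on_mult absolutely_continuous_on_poly) (auto simp: W2_ring_def)
    show "{c..d} \<subseteq> {0..1}" using cd by auto
    fix x assume "x \<in> {c..d} - N"
    then have "(deriv01 m f has_vector_derivative deriv01 (Suc m) f x) (at x within {c..d})"
      using N(2) cd by (intro has_vector_derivative_within_subset[OF N(2)]) auto
    then show "((\<lambda>x. poly q x * deriv01 m f x) has_vector_derivative
        poly q x * deriv01 (Suc m) f x + poly (pderiv q) x * deriv01 m f x) (at x within {c..d})"
      by (intro has_vector_derivative_mult has_vector_derivative_poly)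
  qed
  from has_integral_diff[OF this IH] show ?case
    unfolding Suc_B by (simp add: algebra_simps)
qed

subsection \<open>The reproducing spline\<close>

definition piecewise_poly :: "real \<Rightarrow> real poly \<Rightarrow> real poly \<Rightarrow> real \<Rightarrow> real" where
  "piecewise_poly a P Q x = (if x \<le> a then poly P x else poly Q x)"

text \<open>
  The last clause encodes \<open>U - V = (-1)\<^sup>n\<^sup>-\<^sup>1\<^sup>-\<^sup>k (x - a)\<^sup>2\<^sup>n\<^sup>-\<^sup>1\<^sup>-\<^sup>k / (2n - 1 - k)!\<close> through the derivatives of \<open>U - V\<close>
  at \<open>a\<close>. Up to sign, gluing \<open>U\<close> on \<open>[0;a]\<close> to \<open>V\<close> on \<open>[a;1]\<close> gives the \<open>k\<close>-th derivative in the second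
  argument, at \<open>a\<close>, of the Dirichlet Green function of \<open>D\<^sup>2\<^sup>n\<close>.
\<close>

definition extremal_spline :: "nat \<Rightarrow> nat \<Rightarrow> real \<Rightarrow> real poly \<Rightarrow> real poly \<Rightarrow> bool" where
  "extremal_spline n k a U V \<longleftrightarrow>
     (pderiv ^^ (2 * n)) U = 0 \<and> (pderiv ^^ (2 * n)) V = 0 \<and>
     (\<forall>i<n. poly ((pderiv ^^ i) U) 0 = 0 \<and> poly ((pderiv ^^ i) V) 1 = 0) \<and>
     (\<forall>i. poly ((pderiv ^^ i) U) a - poly ((pderiv ^^ i) V) a =
       (if i = 2 * n - 1 - k then (- 1) ^ (n - 1 - k) else 0))"

lemma has_integral_If_le:
  fixes f g :: "real \<Rightarrow> real"
  assumes "c \<le> a" "a \<le> d" and f: "(f has_integral i) {c..a}" and g: "(g has_integral j) {a..d}"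
  shows "((\<lambda>x. if x \<le> a then f x else g x) has_integral (i + j)) {c..d}"
proof (rule has_integral_combine[OF assms(1,2)])
  show "((\<lambda>x. if x \<le> a then f x else g x) has_integral i) {c..a}"
    using f by (rule has_integral_eq[rotated]) auto
  show "((\<lambda>x. if x \<le> a then f x else g x) has_integral j) {a..d}"
    by (rule has_integral_spike[OF negligible_sing[of a] _ g]) auto
qed

text \<open>Integrate by parts on both sides of the knot. The boundary terms at 0 and 1 vanish with
  the derivatives of \<open>f\<close>; at \<open>a\<close> only the jumps of the derivatives of
  order \<open>n + i\<close> remain. The single nonzero jump, at \<open>i = n - 1 - k\<close>, meets
  the derivative of \<open>f\<close> of order \<open>k\<close>, and the two signs cancel.\<close>

lemma extremal_spline_reproducing:
  assumes f: "f \<in> W2_ring n" and k: "k < n" and a: "0 < a" "a < 1" and UV: "extremal_spline n k a U V"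
  shows "((\<lambda>x. piecewise_poly a ((pderiv ^^ n) U) ((pderiv ^^ n) V) x * deriv01 n f x)
    has_integral deriv01 k f a) {0..1}"
proof -
  let ?B = "\<lambda>P x. \<Sum>i<n. (- 1) ^ i * poly ((pderiv ^^ i) ((pderiv ^^ n) P)) x * deriv01 (n - 1 - i) f x"
  have bd: "?B P 0 = 0" "?B P 1 = 0" for P
    using f by (auto simp: W2_ring_def)
  have top: "(pderiv ^^ n) ((pderiv ^^ n) U) = 0" "(pderiv ^^ n) ((pderiv ^^ n) V) = 0"
    using UV by (simp_all add: extremal_spline_def mult_2 funpow_add)
  have "((\<lambda>x. if x \<le> a then poly ((pderiv ^^ n) U) x * deriv01 n f x
      else poly ((pderiv ^^ n) V) x * deriv01 n f x) has_integral
      ((?B U a - ?B U 0) + (?B V 1 - ?B V a))) {0..1}"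
    using a top by (intro has_integral_If_le W2_ring_by_parts[OF f]) auto
  moreover have "(?B U a - ?B U 0) + (?B V 1 - ?B V a) = deriv01 k f a"
  proof -
    have jet: "poly ((pderiv ^^ i) ((pderiv ^^ n) U)) a - poly ((pderiv ^^ i) ((pderiv ^^ n) V)) a =
        (if i = n - 1 - k then (- 1) ^ (n - 1 - k) else 0)" if "i < n" for i
    proof -
      have "i + n = 2 * n - 1 - k \<longleftrightarrow> i = n - 1 - k" using k that by auto
      then show ?thesis
        using UV by (simp add: extremal_spline_def flip: funpow_add[THEN fun_cong, unfolded comp_def])
    qed
    have "(?B U a - ?B U 0) + (?B V 1 - ?B V a) = ?B U a - ?B V a"
      unfolding bd by simp
    also have "\<dots> = (\<Sum>i<n. (- 1) ^ i * (poly ((pderiv ^^ i) ((pderiv ^^ n) U)) a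
        - poly ((pderiv ^^ i) ((pderiv ^^ n) V)) a) * deriv01 (n - 1 - i) f a)"
      by (simp add: sum_subtractf[symmetric] algebra_simps)
    also have "\<dots> = (\<Sum>i<n. if i = n - 1 - k then deriv01 k f a else 0)"
      by (rule sum.cong) (use k in \<open>auto simp: jet simp flip: power_add\<close>)
    also have "\<dots> = deriv01 k f a" using k by simp
    finally show ?thesis .
  qed
  ultimately show ?thesis
    by (simp add: piecewise_poly_def if_distrib[of "\<lambda>y. y * deriv01 n f _"] cong: if_cong)
qed

section \<open>Piecewise polynomials as elements of \<open>W2_ring n\<close>\<close>

lemma has_vector_derivative_piecewise_poly:
  assumes x: "x \<in> {0..1}" and a: "0 < a" "a < 1"
    and eq: "x = a \<Longrightarrow> poly P a = poly Q a" "x = a \<Longrightarrow> poly (pderiv P) a = poly (pderiv Q) a"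
  shows "(piecewise_poly a P Q has_vector_derivative piecewise_poly a (pderiv P) (pderiv Q) x)
    (at x within {0..1})"
proof -
  \<comment> \<open>The closures of the two pieces meet only at \<open>a\<close>, so values and
    derivatives have to be compared only there.\<close>
  have "((\<lambda>x. if x \<in> {0..a} then poly P x else poly Q x) has_vector_derivative
      (if x \<in> {0..a} then poly (pderiv P) x else poly (pderiv Q) x)) (at x within {0..1})"
    using x a eq
    by (intro has_vector_derivative_If_within_closures[where T = "{a<..1}"] has_vector_derivative_poly)
       auto
  then show ?thesis
    using x by (auto simp: piecewise_poly_def elim!: has_vector_derivative_transform[rotated -1])
qed

text \<open>Agreement of the jets through order \<open>n - 1\<close> makes these derivatives match
  across the knot. The \<open>n\<close>-th derivative may jump at \<open>a\<close>, so it is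
  identified only off \<open>a\<close>; this one-point exception is a null set.\<close>

lemma W2_ring_piecewise_poly:
  assumes a: "0 < a" "a < 1"
    and U: "\<And>i. i < n \<Longrightarrow> poly ((pderiv ^^ i) U) 0 = 0"
    and V: "\<And>i. i < n \<Longrightarrow> poly ((pderiv ^^ i) V) 1 = 0"
    and UV: "\<And>i. i < n \<Longrightarrow> poly ((pderiv ^^ i) U) a = poly ((pderiv ^^ i) V) a"
    and n: "0 < n"
  shows "\<And>j x. j < n \<Longrightarrow> x \<in> {0..1} \<Longrightarrow>
      deriv01 j (piecewise_poly a U V) x = piecewise_poly a ((pderiv ^^ j) U) ((pderiv ^^ j) V) x"
    and "\<And>x. x \<in> {0..1} \<Longrightarrow> x \<noteq> a \<Longrightarrow>
      deriv01 n (piecewise_poly a U V) x = piecewise_poly a ((pderiv ^^ n) U) ((pderiv ^^ n) V) x"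
    and "piecewise_poly a U V \<in> W2_ring n"
proof -
  let ?f = "piecewise_poly a U V"
  let ?S = "\<lambda>j. piecewise_poly a ((pderiv ^^ j) U) ((pderiv ^^ j) V)"
  have S': "(?S j has_vector_derivative ?S (Suc j) x) (at x within {0..1})"
    if "j < n" "x \<in> {0..1}" "x \<noteq> a \<or> Suc j < n" for j x
    using has_vector_derivative_piecewise_poly[of x a "(pderiv ^^ j) U" "(pderiv ^^ j) V"] that a UV[of j] UV[of "Suc j"]
    by auto
  have deriv: "deriv01 j ?f x = ?S j x" if "j < n" "x \<in> {0..1}" for j x
    using that
  proof (induction j arbitrary: x)
    case (Suc j)
    have "(deriv01 j ?f has_vector_derivative ?S (Suc j) x) (at x within {0..1})"
      by (rule has_vector_derivative_transform[OF _ _ S']) (use Suc in auto)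
    then show ?case
      using Suc.prems vector_derivative_within_closed_interval[of 0 1 x "deriv01 j ?f"] by simp
  qed simp
  have hd: "(deriv01 j ?f has_vector_derivative ?S (Suc j) x) (at x within {0..1})"
    if "j < n" "x \<in> {0..1}" "x \<noteq> a \<or> Suc j < n" for j x
    by (rule has_vector_derivative_transform[OF _ _ S']) (use deriv that in auto)
  have top: "deriv01 n ?f x = ?S n x" if "x \<in> {0..1}" "x \<noteq> a" for x
    using hd[of "n - 1" x] that n vector_derivative_within_closed_interval[of 0 1 x "deriv01 (n - 1) ?f"]
    by (cases n) simp_all
  show "\<And>j x. j < n \<Longrightarrow> x \<in> {0..1} \<Longrightarrow> deriv01 j ?f x = ?S j x" by (fact deriv)
  show "\<And>x. x \<in> {0..1} \<Longrightarrow> x \<noteq> a \<Longrightarrow> deriv01 n ?f x = ?S n x" by (fact top)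
  have ac: "absolutely_continuous_on {0..1} (deriv01 j ?f)" if j: "j < n" for j
  proof -
    let ?P = "poly ((pderiv ^^ j) U)" and ?Q = "poly ((pderiv ^^ j) V)"
    obtain K L where K: "\<And>x y. 0 \<le> x \<Longrightarrow> x \<le> y \<Longrightarrow> y \<le> 1 \<Longrightarrow> \<bar>?P y - ?P x\<bar> \<le> K * (y - x)"
      and L: "\<And>x y. 0 \<le> x \<Longrightarrow> x \<le> y \<Longrightarrow> y \<le> 1 \<Longrightarrow> \<bar>?Q y - ?Q x\<bar> \<le> L * (y - x)"
      using poly_lipschitz_on_Icc by metis
    define M where "M = max K L"
    have KM: "\<bar>?P y - ?P x\<bar> \<le> M * (y - x)" if "0 \<le> x" "x \<le> y" "y \<le> 1" for x y
      using K[OF that] mult_right_mono[of K M "y - x"] that by (simp add: M_def)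
    have LM: "\<bar>?Q y - ?Q x\<bar> \<le> M * (y - x)" if "0 \<le> x" "x \<le> y" "y \<le> 1" for x y
      using L[OF that] mult_right_mono[of L M "y - x"] that by (simp add: M_def)
    show ?thesis
    proof (rule absolutely_continuous_on_lipschitz)
      fix x y :: real assume xy: "x \<in> {0..1}" "y \<in> {0..1}" "x \<le> y"
      have "\<bar>?S j y - ?S j x\<bar> \<le> M * (y - x)"
      \<comment> \<open>A pair straddling the knot is compared through \<open>a\<close>, where both
        polynomials take the same value.\<close>
      proof (cases "x \<le> a \<and> a < y")
        case True
        have "\<bar>?Q y - ?P x\<bar> \<le> \<bar>?Q y - ?Q a\<bar> + \<bar>?P a - ?P x\<bar>"
          using UV[OF j] by linarith
        also have "\<dots> \<le> M * (y - a) + M * (a - x)"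
          using True xy a by (intro add_mono KM LM) auto
        also have "\<dots> = M * (y - x)" by (simp add: algebra_simps)
        finally show ?thesis using True by (simp add: piecewise_poly_def)
      next
        case False
        then show ?thesis using KM[of x y] LM[of x y] xy by (auto simp: piecewise_poly_def)
      qed
      then show "\<bar>deriv01 j ?f y - deriv01 j ?f x\<bar> \<le> M * (y - x)"
        using deriv[OF j] xy by simp
    qed
  qed
  have "AE x in lebesgue. x \<in> {0..1} \<longrightarrow> deriv01 (n - 1) ?f differentiable (at x within {0..1})"
  proof (rule AE_I')
    show "{a} \<in> null_sets lebesgue"
      using negligible_sing[of a] by (simp add: negligible_iff_null_sets)
    show "{x \<in> space lebesgue. \<not> (x \<in> {0..1} \<longrightarrow> deriv01 (n - 1) ?f differentiable (at x within {0..1}))} \<subseteq> {a}"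
      using hd[of "n - 1"] n by (auto intro: differentiableI_vector)
  qed
  moreover have "deriv01 n ?f \<in> L2_01"
  proof -
    have [measurable]: "poly p \<in> borel_measurable borel" for p :: "real poly"
      by (intro borel_measurable_continuous_onI continuous_intros)
    \<comment> \<open>The possibly unspecified value of \<open>deriv01 n\<close> at \<open>a\<close>
      is carried along as a constant, so that the representative equals the given function
      everywhere and not merely almost everywhere.\<close>
    have "(\<lambda>x. if x = a then deriv01 n ?f a else indicator {0..1} x * ?S n x) \<in> borel_measurable borel"
      unfolding piecewise_poly_def by measurable
    then have "(\<lambda>x. if x = a then deriv01 n ?f a else indicator {0..1} x * ?S n x) \<in> borel_measurable lebesgue"
      by (intro measurable_completion) simp
    also have "(\<lambda>x. if x = a then deriv01 n ?f a else indicator {0..1} x * ?S n x) =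
        (\<lambda>x. indicator {0..1} x *\<^sub>R deriv01 n ?f x)"
      using top a by (auto simp: fun_eq_iff indicator_def)
    finally have "set_borel_measurable lebesgue {0..1} (deriv01 n ?f)"
      by (simp add: set_borel_measurable_def)
    moreover have "(\<lambda>x. \<bar>deriv01 n ?f x\<bar>\<^sup>2) integrable_on {0..1}"
    proof -
      have "\<exists>i. ((\<lambda>x. poly P x ^ 2) has_integral i) {c..d}" for P and c d :: real
        unfolding integrable_on_def[symmetric]
        by (intro integrable_continuous_interval continuous_intros)
      then obtain i j where "((\<lambda>x. poly ((pderiv ^^ n) U) x ^ 2) has_integral i) {0..a}"
        "((\<lambda>x. poly ((pderiv ^^ n) V) x ^ 2) has_integral j) {a..1}"
        by blast
      then have "((\<lambda>x. if x \<le> a then poly ((pderiv ^^ n) U) x ^ 2 else poly ((pderiv ^^ n) V) x ^ 2)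
          has_integral i + j) {0..1}"
        using a by (intro has_integral_If_le) auto
      then have "((\<lambda>x. \<bar>deriv01 n ?f x\<bar>\<^sup>2) has_integral i + j) {0..1}"
        by (rule has_integral_spike[OF negligible_sing[of a], rotated]) (use top in \<open>auto simp: piecewise_poly_def\<close>)
      then show ?thesis by blast
    qed
    then have "set_integrable lebesgue {0..1} (\<lambda>x. \<bar>deriv01 n ?f x\<bar>\<^sup>2)"
      by (rule nonnegative_absolutely_integrable_1) simp
    ultimately show ?thesis by (simp add: L2_01_def)
  qed
  moreover have "deriv01 j ?f 0 = 0 \<and> deriv01 j ?f 1 = 0" if "j < n" for j
    using deriv[OF that, of 0] deriv[OF that, of 1] U V a that by (simp add: piecewise_poly_def)
  moreover have "deriv01 j ?f differentiable_on {0..1}" if "Suc j < n" for j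
    unfolding differentiable_on_def
    by (intro ballI differentiableI_vector[OF hd]) (use that in auto)
  ultimately show "?f \<in> W2_ring n"
    using ac by (auto simp: W2_ring_def)
qed

text \<open>Taking the glued spline itself for \<open>f\<close> in the reproducing formula shows
  that the asserted value is the squared norm of its \<open>n\<close>-th derivative. Cauchy-Schwarz
  then bounds the functional by the square root, and the normalised spline attains it.\<close>

theorem A_sup_extremal_spline:
  assumes k: "k < n" and a: "0 < a" "a < 1" and UV: "extremal_spline n k a U V"
  shows "(A_sup n k a)\<^sup>2 = ereal (poly ((pderiv ^^ k) U) a)"
proof -
  define v where "v = poly ((pderiv ^^ k) U) a"
  let ?w = "piecewise_poly a ((pderiv ^^ n) U) ((pderiv ^^ n) V)"
  have n: "0 < n" using k by simp
  have jets: "poly ((pderiv ^^ i) U) 0 = 0" "poly ((pderiv ^^ i) V) 1 = 0"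
    "poly ((pderiv ^^ i) U) a = poly ((pderiv ^^ i) V) a" if "i < n" for i
  proof -
    have "i \<noteq> 2 * n - 1 - k" using that k by linarith
    then have "poly ((pderiv ^^ i) U) a - poly ((pderiv ^^ i) V) a = 0"
      using UV unfolding extremal_spline_def by (metis (no_types))
    then show "poly ((pderiv ^^ i) U) a = poly ((pderiv ^^ i) V) a" by simp
  qed (use UV that in \<open>simp_all add: extremal_spline_def\<close>)
  \<comment> \<open>Scalar multiples of the spline: \<open>c = 1\<close> yields its norm, and
    \<open>c = 1 / sqrt v\<close> the extremal function.\<close>
  define F where "F c = piecewise_poly a (smult c U) (smult c V)" for c
  have jets_smult: "poly ((pderiv ^^ i) (smult c U)) 0 = 0" "poly ((pderiv ^^ i) (smult c V)) 1 = 0"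
    "poly ((pderiv ^^ i) (smult c U)) a = poly ((pderiv ^^ i) (smult c V)) a" if "i < n" for i c
    using jets[OF that] by (simp_all add: higher_pderiv_smult)
  have FW: "F c \<in> W2_ring n" for c
    unfolding F_def by (rule W2_ring_piecewise_poly(3)[OF a jets_smult n])
  have Fk: "deriv01 k (F c) a = c * v" for c
    using W2_ring_piecewise_poly(1)[OF a jets_smult n k, of a c] a
    by (simp add: F_def piecewise_poly_def higher_pderiv_smult v_def)
  have Fn: "deriv01 n (F c) x = c * ?w x" if "x \<in> {0..1} - {a}" for c x
    using W2_ring_piecewise_poly(2)[OF a jets_smult n, of x c] that
    by (simp add: F_def piecewise_poly_def higher_pderiv_smult)
  have ww: "((\<lambda>x. ?w x ^ 2) has_integral v) {0..1}"
    using extremal_spline_reproducing[OF FW[of 1] k a UV, unfolded Fk mult_1]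
    by (rule has_integral_spike[OF negligible_sing[of a], rotated])
       (use Fn[of _ 1] in \<open>auto simp: power2_eq_square\<close>)
  have v0: "0 \<le> v" by (rule has_integral_nonneg[OF ww]) simp
  have upper: "\<bar>deriv01 k f a\<bar> \<le> sqrt v"
    if f: "f \<in> W2_ring n" and le: "(LINT x:{0..1}|lebesgue. \<bar>deriv01 n f x\<bar>\<^sup>2) \<le> 1" for f
  proof -
    define b where "b = deriv01 k f a"
    define I where "I = (LINT x:{0..1}|lebesgue. \<bar>deriv01 n f x\<bar>\<^sup>2)"
    have "set_integrable lebesgue {0..1} (\<lambda>x. \<bar>deriv01 n f x\<bar>\<^sup>2)"
      using f by (simp add: W2_ring_def L2_01_def)
    then have gg: "((\<lambda>x. \<bar>deriv01 n f x\<bar>\<^sup>2) has_integral I) {0..1}"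
      unfolding I_def by (rule has_integral_set_lebesgue)
    have wg: "((\<lambda>x. ?w x * deriv01 n f x) has_integral b) {0..1}"
      using extremal_spline_reproducing[OF f k a UV] by (simp add: b_def)
    \<comment> \<open>Cauchy-Schwarz through its quadratic: the integral of the square of
      \<open>deriv01 n f x - c * ?w x\<close> is nonnegative, and \<open>I \<le> 1\<close>.\<close>
    have quad: "0 \<le> 1 - 2 * c * b + c\<^sup>2 * v" for c
    proof -
      have "((\<lambda>x. \<bar>deriv01 n f x\<bar>\<^sup>2 - (2 * c) * (?w x * deriv01 n f x) + c\<^sup>2 * ?w x ^ 2)
          has_integral I - (2 * c) * b + c\<^sup>2 * v) {0..1}"
        by (intro has_integral_add has_integral_diff has_integral_mult_right gg wg ww)
      then have "0 \<le> I - (2 * c) * b + c\<^sup>2 * v"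
      proof (rule has_integral_nonneg)
        fix x
        have "\<bar>deriv01 n f x\<bar>\<^sup>2 - (2 * c) * (?w x * deriv01 n f x) + c\<^sup>2 * ?w x ^ 2 = (deriv01 n f x - c * ?w x)\<^sup>2"
          by (simp add: power2_eq_square algebra_simps)
        then show "0 \<le> \<bar>deriv01 n f x\<bar>\<^sup>2 - (2 * c) * (?w x * deriv01 n f x) + c\<^sup>2 * ?w x ^ 2" by simp
      qed
      then show ?thesis using le by (simp add: I_def)
    qed
    have "b\<^sup>2 \<le> v"
    \<comment> \<open>For \<open>v = 0\<close> the quadratic is affine in \<open>c\<close>, and
      \<open>c = 1 / b\<close> would make it -1. Otherwise \<open>c = b / v\<close> is its
      minimum.\<close>
    proof (cases "v = 0")
      case True
      have "b = 0"
      proof (rule ccontr)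
        assume "b \<noteq> 0"
        then show False using quad[of "1 / b"] True by simp
      qed
      then show ?thesis using v0 by simp
    next
      case False
      then show ?thesis using quad[of "b / v"] v0 by (simp add: power2_eq_square field_simps)
    qed
    then show ?thesis unfolding b_def[symmetric] by (simp add: real_le_rsqrt)
  qed
  \<comment> \<open>If \<open>v = 0\<close>, division by zero gives \<open>c = 0\<close>, and the
    zero function attains the supremum 0.\<close>
  define c where "c = 1 / sqrt v"
  have cv: "c * v = sqrt v" "c\<^sup>2 * v \<le> 1"
    using v0 by (auto simp: c_def real_div_sqrt power_divide)
  have "((\<lambda>x. c\<^sup>2 * ?w x ^ 2) has_integral c\<^sup>2 * v) {0..1}"
    by (intro has_integral_mult_right ww)
  then have int: "((\<lambda>x. \<bar>deriv01 n (F c) x\<bar>\<^sup>2) has_integral c\<^sup>2 * v) {0..1}"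
    by (rule has_integral_spike[OF negligible_sing[of a], rotated]) (simp add: Fn power_mult_distrib)
  have "set_integrable lebesgue {0..1} (\<lambda>x. \<bar>deriv01 n (F c) x\<bar>\<^sup>2)"
    using FW[of c] by (simp add: W2_ring_def L2_01_def)
  then have "(LINT x:{0..1}|lebesgue. \<bar>deriv01 n (F c) x\<bar>\<^sup>2) = c\<^sup>2 * v"
    using int has_integral_set_lebesgue has_integral_unique by blast
  then have attained: "ereal (sqrt v) \<in> {ereal \<bar>deriv01 k f a\<bar> | f.
     f \<in> W2_ring n \<and> (LINT x:{0..1}|lebesgue. \<bar>deriv01 n f x\<bar>\<^sup>2) \<le> 1}"
    using FW[of c] Fk[of c] cv v0 by (intro CollectI exI[of _ "F c"]) simp
  have "A_sup n k a = ereal (sqrt v)"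
    unfolding A_sup_def
    by (intro antisym Sup_least Sup_upper attained) (use upper in auto)
  then show ?thesis
    using v0 by (simp add: v_def)
qed

subsection \<open>Construction of the spline\<close>

text \<open>Differentiation lowers the multiplicity of a factor by at most one. Truncated
  subtraction makes the claim trivial once \<open>i \<ge> n\<close>.\<close>

lemma power_dvd_higher_pderiv:
  fixes p q :: "'a::{comm_semiring_1,semiring_no_zero_divisors} poly"
  assumes "q ^ n dvd p"
  shows "q ^ (n - i) dvd (pderiv ^^ i) p"
proof (induction i)
  case (Suc i)
  show ?case
  proof (cases "n - i")
    case (Suc m)
    then obtain s where "(pderiv ^^ i) p = q ^ Suc m * s" using Suc.IH by (auto elim: dvdE)
    then have "(pderiv ^^ Suc i) p = q ^ m * (smult (of_nat (Suc m)) (pderiv q * s) + q * pderiv s)"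
      by (simp add: pderiv_mult pderiv_power_Suc algebra_simps del: power_Suc) (simp add: algebra_simps)
    moreover have "n - Suc i = m" using Suc by simp
    ultimately show ?thesis by simp
  qed auto
qed (use assms in simp)

lemma poly_higher_pderiv_eq_0:
  fixes p :: "real poly"
  assumes "[:-c, 1:] ^ n dvd p" "i < n"
  shows "poly ((pderiv ^^ i) p) c = 0"
proof -
  have "[:-c, 1:] dvd [:-c, 1:] ^ (n - i)" using assms(2) by simp
  then have "[:-c, 1:] dvd (pderiv ^^ i) p" using power_dvd_higher_pderiv[OF assms(1)] dvd_trans by blast
  then show ?thesis by (simp add: poly_eq_0_iff_dvd)
qed

lemma poly_higher_pderiv_linear_power:
  fixes a :: real
  shows "poly ((pderiv ^^ i) ([:-a, 1:] ^ m)) a = (if i = m then fact m else 0)"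
proof (induction m arbitrary: i)
  case 0
  then show ?case by (cases i) (simp_all add: funpow_Suc_right del: funpow.simps)
next
  case (Suc m)
  show ?case
  proof (cases i)
    case (Suc i')
    have "pderiv ([:-a, 1:] ^ Suc m) = smult (of_nat (Suc m)) ([:-a, 1:] ^ m)"
      by (subst pderiv_power_Suc) (simp add: pderiv_pCons)
    then show ?thesis
      using Suc.IH[of i'] Suc by (simp add: funpow_Suc_right higher_pderiv_smult del: funpow.simps power_Suc)
  qed simp
qed

lemma higher_pderiv_eq_0:
  fixes p :: "real poly"
  assumes "degree p < m"
  shows "(pderiv ^^ m) p = 0"
  using assms by (intro poly_eqI) (simp add: coeff_higher_pderiv coeff_eq_0)

lemma higher_pderiv_degree:
  fixes p :: "real poly"
  assumes "degree p = m"
  shows "(pderiv ^^ m) p = [:fact m * lead_coeff p:]"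
proof (rule poly_eqI)
  fix i show "coeff ((pderiv ^^ m) p) i = coeff [:fact m * lead_coeff p:] i"
    using assms by (cases i) (simp_all add: coeff_higher_pderiv coeff_eq_0 pochhammer_fact)
qed

section \<open>Explicit primitives, and powers of \<open>tau\<close>\<close>

text \<open>The bilinear concomitant of the operator D^m. It expresses primitives by products of
  derivatives, so their values at 0, 1 and \<open>a\<close> follow from the jets of the
  factors.\<close>

definition by_parts_poly :: "nat \<Rightarrow> real poly \<Rightarrow> real poly \<Rightarrow> real poly" where
  "by_parts_poly m P T = (\<Sum>i<m. smult ((- 1) ^ i) ((pderiv ^^ i) P * (pderiv ^^ (m - 1 - i)) T))"

text \<open>Lagrange's identity for D^m; the induction trades \<open>T\<close> for
  \<open>pderiv T\<close>. When the \<open>m\<close>-th derivatives of \<open>T\<close> and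
  \<open>P\<close> are 1 and 0, it makes \<open>by_parts_poly m P T\<close> a primitive of
  \<open>P\<close>.\<close>

lemma pderiv_by_parts_poly:
  "pderiv (by_parts_poly m P T) = P * (pderiv ^^ m) T - smult ((- 1) ^ m) ((pderiv ^^ m) P * T)"
proof (induction m arbitrary: T)
  case 0
  then show ?case by (simp add: by_parts_poly_def)
next
  case (Suc m)
  have "by_parts_poly (Suc m) P T = by_parts_poly m P (pderiv T) + smult ((- 1) ^ m) ((pderiv ^^ m) P * T)"
    unfolding by_parts_poly_def
    by (simp, intro sum.cong refl)
       (simp add: Suc_diff_Suc flip: funpow_swap1 funpow.simps(2)[THEN fun_cong, unfolded comp_def])
  then show ?case
    by (simp add: Suc.IH pderiv_add pderiv_smult pderiv_mult funpow_swap1 smult_add_right mult.commute)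
qed

lemma poly_by_parts_poly:
  "poly (by_parts_poly m P T) x =
    (\<Sum>i<m. (- 1) ^ i * (poly ((pderiv ^^ i) P) x * poly ((pderiv ^^ (m - 1 - i)) T) x))"
  by (simp add: by_parts_poly_def poly_sum)

abbreviation tau :: "real poly" where "tau \<equiv> [:0, -1, 1:]"

lemma tau_eq: "tau = [:0, 1:] * [:-1, 1:]"
  by simp

lemma poly_higher_pderiv_tau_eq_0:
  assumes "i < n"
  shows "poly ((pderiv ^^ i) (tau ^ n)) 0 = 0" "poly ((pderiv ^^ i) (tau ^ n)) 1 = 0"
proof -
  have "[:- 0, 1:] ^ n dvd tau ^ n" "[:- 1, 1:] ^ n dvd tau ^ n"
    unfolding tau_eq power_mult_distrib by simp_all
  with assms show "poly ((pderiv ^^ i) (tau ^ n)) 0 = 0" "poly ((pderiv ^^ i) (tau ^ n)) 1 = 0"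
    by (blast intro: poly_higher_pderiv_eq_0)+
qed

lemma degree_tau_power: "degree (tau ^ n) = 2 * n" "lead_coeff (tau ^ n) = 1"
proof -
  show "degree (tau ^ n) = 2 * n" by (simp add: degree_power_eq)
  show "lead_coeff (tau ^ n) = 1" by (simp only: lead_coeff_power) simp
qed

text \<open>Since \<open>J\<close> vanishes at 1, the value at 0 is minus a beta integral over
  [0;1]. It comes from integrating x^n against (x-1)^n, with (x-1)^n written as an
  \<open>n\<close>-th derivative.\<close>

lemma tau_power_primitive:
  obtains J :: "real poly" where "pderiv J = tau ^ n" "poly J 1 = 0"
    "poly J 0 = - ((- 1) ^ n * (fact n)\<^sup>2 / fact (2 * n + 1))"
proof -
  \<comment> \<open>This factor makes (x-1)^n the \<open>n\<close>-th derivative of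
    \<open>T\<close>.\<close>
  define \<kappa> :: real where "\<kappa> = fact n / fact (2 * n)"
  define P T :: "real poly" where "P = [:0, 1:] ^ n" and "T = smult \<kappa> ([:-1, 1:] ^ (2 * n))"
  \<comment> \<open>The second summand cancels the term that Lagrange's identity leaves, a constant
    multiple of (x-1)^(2n). At 0 it alone survives, because the derivatives of \<open>P\<close> of
    order below \<open>n\<close> vanish there.\<close>
  define J where "J = by_parts_poly n P T +
    smult ((- 1) ^ n * fact n * \<kappa> / (2 * real n + 1)) ([:-1, 1:] ^ (2 * n + 1))"
  have pd: "pderiv ([:-1, 1:] ^ Suc m) = smult (real (Suc m)) ([:-1, 1:] ^ m)" for m :: nat
    by (subst pderiv_power_Suc) (simp add: pderiv_pCons)
  have Tn: "(pderiv ^^ n) T = [:-1, 1:] ^ n"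
  proof -
    have "i \<le> m \<Longrightarrow> (pderiv ^^ i) ([:-1, 1:] ^ m) = smult (fact m / fact (m - i)) ([:-1, 1:] ^ (m - i) :: real poly)" for i m :: nat
    proof (induction i)
      case (Suc i)
      then obtain l where l: "m - i = Suc l" "m - Suc i = l" by (metis Suc_diff_Suc Suc_le_lessD)
      show ?case using Suc l by (simp add: pderiv_smult pd del: power_Suc)
    qed simp
    from this[of n "2 * n"] show ?thesis
      by (simp add: T_def higher_pderiv_smult \<kappa>_def)
  qed
  have "degree P = n" by (simp add: P_def degree_power_eq)
  moreover have "lead_coeff P = 1" by (simp only: P_def lead_coeff_power) simp
  ultimately have Pn: "(pderiv ^^ n) P = [:fact n:]"
    using higher_pderiv_degree[of P n] by simp
  have "pderiv (smult (K / (2 * real n + 1)) ([:-1, 1:] ^ (2 * n + 1))) = smult K ([:-1, 1:] ^ (2 * n))" for K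
    using pd[of "2 * n"] by (simp add: pderiv_smult add.commute del: power_Suc)
  then have "pderiv J = P * [:-1, 1:] ^ n"
    unfolding J_def pderiv_add pderiv_by_parts_poly Tn Pn by (simp add: T_def mult_ac)
  then have 1: "pderiv J = tau ^ n"
    by (simp only: P_def tau_eq power_mult_distrib)
  have P0: "poly ((pderiv ^^ i) P) 0 = 0" if "i < n" for i
    using poly_higher_pderiv_eq_0[of 0 n P i] that by (simp add: P_def)
  have T1: "poly ((pderiv ^^ i) T) 1 = 0" if "i < n" for i
    using poly_higher_pderiv_eq_0[of 1 "2 * n" T i] that by (simp add: T_def dvd_smult)
  have 2: "poly J 1 = 0"
    by (simp add: J_def poly_by_parts_poly T1)
  have 3: "poly J 0 = - ((- 1) ^ n * (fact n)\<^sup>2 / fact (2 * n + 1))"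
    by (simp add: J_def poly_by_parts_poly P0 \<kappa>_def power2_eq_square field_simps)
  show thesis using that 1 2 3 .
qed

text \<open>
  The primitives of \<open>U\<close> and \<open>V\<close> vanishing at \<open>0\<close> and \<open>1\<close> are \<open>by_parts_poly (2 * n) U T\<close> and
  \<open>by_parts_poly (2 * n) V T\<close>, where \<open>T\<close> is the multiple of \<open>(x\<^sup>2 - x)\<^sup>n\<close> with \<open>2n\<close>-th derivative \<open>1\<close>. They
  differ by a constant at \<open>a\<close>, which a multiple of the primitive of \<open>(x\<^sup>2 - x)\<^sup>n\<close> absorbs.
\<close>

lemma extremal_spline_Suc:
  assumes UV: "extremal_spline n k a U V" and k: "k < n"
  obtains U' V' where "extremal_spline (Suc n) (Suc k) a U' V'"
    "poly ((pderiv ^^ Suc k) U') a = poly ((pderiv ^^ k) U) a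
      - (2 * real n + 1) / (fact n)\<^sup>2 * (poly ((pderiv ^^ k) (tau ^ n)) a)\<^sup>2"
proof -
  obtain J where J: "pderiv J = tau ^ n" "poly J 1 = 0"
    "poly J 0 = - ((- 1) ^ n * (fact n)\<^sup>2 / fact (2 * n + 1))"
    by (rule tau_power_primitive[of n])
  define D where "D = poly ((pderiv ^^ k) (tau ^ n)) a"
  \<comment> \<open>Forced by continuity at \<open>a\<close>: \<open>e * poly J 0\<close> must
    cancel the difference of the primitives \<open>B U\<close> and \<open>B V\<close> there.\<close>
  define e where "e = (2 * real n + 1) / (fact n)\<^sup>2 * D"
  define T where "T = smult (1 / fact (2 * n)) (tau ^ n)"
  define B where "B P = by_parts_poly (2 * n) P T" for P
  \<comment> \<open>\<open>J\<close> already vanishes at 1; on the left piece its value at 0 is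
    removed, so both new pieces keep their zero at the endpoint.\<close>
  define U' where "U' = B U - smult e (J - [:poly J 0:])"
  define V' where "V' = B V - smult e J"
  have U2: "(pderiv ^^ (2 * n)) U = 0" and V2: "(pderiv ^^ (2 * n)) V = 0"
    and jet0: "\<And>i. i < n \<Longrightarrow> poly ((pderiv ^^ i) U) 0 = 0" "\<And>i. i < n \<Longrightarrow> poly ((pderiv ^^ i) V) 1 = 0"
    and jeta: "\<And>i. poly ((pderiv ^^ i) U) a - poly ((pderiv ^^ i) V) a =
       (if i = 2 * n - 1 - k then (- 1) ^ (n - 1 - k) else 0)"
    using UV unfolding extremal_spline_def by blast+
  have T2: "(pderiv ^^ (2 * n)) T = 1"
    using higher_pderiv_degree[OF degree_tau_power(1), of n] degree_tau_power(2)[of n]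
    by (simp add: T_def higher_pderiv_smult one_pCons)
  have T0: "poly ((pderiv ^^ i) T) 0 = 0" "poly ((pderiv ^^ i) T) 1 = 0" if "i < n" for i
    using poly_higher_pderiv_tau_eq_0[OF that] by (simp_all add: T_def higher_pderiv_smult)
  have pdU: "pderiv U' = U - smult e (tau ^ n)"
    by (simp add: U'_def B_def pderiv_diff pderiv_smult pderiv_by_parts_poly U2 T2 J(1) pderiv_pCons)
  have pdV: "pderiv V' = V - smult e (tau ^ n)"
    by (simp add: V'_def B_def pderiv_diff pderiv_smult pderiv_by_parts_poly V2 T2 J(1))
  have diff: "(pderiv ^^ i) (p - smult e q) = (pderiv ^^ i) p - smult e ((pderiv ^^ i) q)" for i and p q :: "real poly"
    using higher_pderiv_add[of i p "smult (-e) q"] unfolding higher_pderiv_smult by simp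
  have SucU: "(pderiv ^^ Suc i) U' = (pderiv ^^ i) U - smult e ((pderiv ^^ i) (tau ^ n))" for i
    by (simp add: funpow_Suc_right pdU diff del: funpow.simps)
  have SucV: "(pderiv ^^ Suc i) V' = (pderiv ^^ i) V - smult e ((pderiv ^^ i) (tau ^ n))" for i
    by (simp add: funpow_Suc_right pdV diff del: funpow.simps)
  have BU0: "poly (B U) 0 = 0"
    unfolding B_def poly_by_parts_poly
  proof (intro sum.neutral ballI)
    fix i assume "i \<in> {..<2 * n}"
    \<comment> \<open>The two orders of differentiation add up to \<open>2 * n - 1\<close>, so one
      of them is below \<open>n\<close> and its factor vanishes at the endpoint.\<close>
    then have "i < n \<or> 2 * n - 1 - i < n" by auto
    then show "(- 1) ^ i * (poly ((pderiv ^^ i) U) 0 * poly ((pderiv ^^ (2 * n - 1 - i)) T) 0) = 0"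
      using jet0 T0 by auto
  qed
  have BV1: "poly (B V) 1 = 0"
    unfolding B_def poly_by_parts_poly
  proof (intro sum.neutral ballI)
    fix i assume "i \<in> {..<2 * n}"
    then have "i < n \<or> 2 * n - 1 - i < n" by auto
    then show "(- 1) ^ i * (poly ((pderiv ^^ i) V) 1 * poly ((pderiv ^^ (2 * n - 1 - i)) T) 1) = 0"
      using jet0 T0 by auto
  qed
  have "poly (B U) a - poly (B V) a =
      (\<Sum>i<2 * n. (- 1) ^ i * ((poly ((pderiv ^^ i) U) a - poly ((pderiv ^^ i) V) a)
        * poly ((pderiv ^^ (2 * n - 1 - i)) T) a))"
    unfolding B_def poly_by_parts_poly by (simp add: sum_subtractf[symmetric] algebra_simps)
  \<comment> \<open>The only nonzero jump, of order \<open>2 * n - 1 - k\<close>, is paired with the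
    derivative of \<open>T\<close> of order \<open>k\<close>. This is how \<open>D\<close>
    enters.\<close>
  also have "\<dots> = (\<Sum>i<2 * n. if i = 2 * n - 1 - k then
      (- 1) ^ (2 * n - 1 - k) * ((- 1) ^ (n - 1 - k) * poly ((pderiv ^^ k) T) a) else 0)"
    by (rule sum.cong) (use k in \<open>auto simp: jeta\<close>)
  also have "\<dots> = (- 1) ^ (2 * n - 1 - k) * ((- 1) ^ (n - 1 - k) * poly ((pderiv ^^ k) T) a)"
    using k by simp
  also have "\<dots> = (- 1) ^ n * D / fact (2 * n)"
  proof -
    have "(2 * n - 1 - k) + (n - 1 - k) = n + 2 * (n - 1 - k)" using k by simp
    then have "(- 1) ^ (2 * n - 1 - k) * (- 1) ^ (n - 1 - k) = ((- 1) ^ n :: real)"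
      by (metis (no_types, lifting) power_add power_mult mult.right_neutral power_one power2_minus one_power2)
    then show ?thesis
      by (simp add: T_def higher_pderiv_smult D_def mult.assoc[symmetric])
  qed
  finally have "poly (B U) a - poly (B V) a = (- 1) ^ n * D / fact (2 * n)" .
  moreover have "e * poly J 0 = - ((- 1) ^ n * D / fact (2 * n))"
  proof -
    \<comment> \<open>To be read with \<open>p\<close> = 2n + 1, \<open>F\<close> = (n!)^2,
      \<open>s\<close> = (-1)^n and \<open>G\<close> = (2n)!.\<close>
    have "p / F * D * (- (s * F / (p * G))) = - (s * D / G)" if "p \<noteq> 0" "F \<noteq> 0" for p F s G :: real
      using that by simp
    moreover have "fact (2 * n + 1) = (2 * real n + 1) * fact (2 * n)" by simp
    moreover have "2 * real n + 1 \<noteq> 0" by linarith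
    ultimately show ?thesis
      unfolding e_def J(3) by (simp only:) simp
  qed
  ultimately have match: "poly U' a - poly V' a = 0"
    by (simp add: U'_def V'_def algebra_simps)
  have "extremal_spline (Suc n) (Suc k) a U' V'"
    unfolding extremal_spline_def
  proof (intro conjI allI impI)
    \<comment> \<open>The subtracted power has degree exactly \<open>2 * n\<close>; the derivative
      of \<open>U'\<close> is differentiated \<open>2 * n + 1\<close> times, which is just enough to
      kill it.\<close>
    have "degree (tau ^ n) < Suc (2 * n)" by (simp add: degree_tau_power)
    then have "(pderiv ^^ Suc (2 * n)) (tau ^ n) = 0" by (rule higher_pderiv_eq_0)
    moreover have "2 * Suc n = Suc (Suc (2 * n))" by simp
    ultimately show "(pderiv ^^ (2 * Suc n)) U' = 0" "(pderiv ^^ (2 * Suc n)) V' = 0"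
      using U2 V2 by (simp_all only: SucU SucV) simp_all
  next
    fix i assume i: "i < Suc n"
    show "poly ((pderiv ^^ i) U') 0 = 0"
    proof (cases i)
      case 0
      then show ?thesis by (simp add: U'_def BU0)
    next
      case (Suc i')
      then show ?thesis
        using i jet0 poly_higher_pderiv_tau_eq_0[of i' n] by (simp only: SucU) simp
    qed
    show "poly ((pderiv ^^ i) V') 1 = 0"
    proof (cases i)
      case 0
      then show ?thesis by (simp add: V'_def BV1 J(2))
    next
      case (Suc i')
      then show ?thesis
        using i jet0 poly_higher_pderiv_tau_eq_0[of i' n] by (simp only: SucV) simp
    qed
  next
    fix i
    show "poly ((pderiv ^^ i) U') a - poly ((pderiv ^^ i) V') a =
       (if i = 2 * Suc n - 1 - Suc k then (- 1) ^ (Suc n - 1 - Suc k) else 0)"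
    proof (cases i)
      case 0
      then show ?thesis using match k by simp
    next
      case (Suc i')
      have "i = 2 * Suc n - 1 - Suc k \<longleftrightarrow> i' = 2 * n - 1 - k" using Suc k by auto
      moreover have "poly ((pderiv ^^ i) U') a - poly ((pderiv ^^ i) V') a =
          poly ((pderiv ^^ i') U) a - poly ((pderiv ^^ i') V) a"
        unfolding Suc SucU SucV by simp
      ultimately show ?thesis using jeta[of i'] by simp
    qed
  qed
  moreover have "poly ((pderiv ^^ Suc k) U') a = poly ((pderiv ^^ k) U) a
      - (2 * real n + 1) / (fact n)\<^sup>2 * (poly ((pderiv ^^ k) (tau ^ n)) a)\<^sup>2"
    unfolding SucU by (simp add: e_def D_def power2_eq_square)
  ultimately show thesis by (rule that)
qed

section \<open>The initial spline, for \<open>k = 0\<close>\<close>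

text \<open>Pascal's rule in the induction. With \<open>m = 2 * s\<close> and \<open>k = s\<close>
  it yields the central binomial coefficient in the value of the initial spline at
  \<open>a\<close>.\<close>

lemma alternating_binomial_partial_sum:
  "(\<Sum>i\<le>k. (- 1) ^ i * real (Suc m choose i)) = (- 1) ^ k * real (m choose k)"
  by (induction k) (simp_all add: algebra_simps)

text \<open>
  Expand \<open>(a - x)\<^sup>2\<^sup>r\<^sup>-\<^sup>1\<close> binomially as a power of \<open>a (1 - x) - (1 - a) x\<close>: each term is divisible by \<open>x\<^sup>r\<close> or by
  \<open>(1 - x)\<^sup>r\<close>.
\<close>

lemma extremal_spline_0:
  assumes r: "0 < r"
  obtains U V where "extremal_spline r 0 a U V"
    "poly U a = - ((a\<^sup>2 - a) ^ (2 * r - 1) / ((2 * real r - 1) * (fact (r - 1))\<^sup>2))"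
proof -
  define m where "m = 2 * r - 1"
  \<comment> \<open>These are a(1-x) and -(1-a)x, with sum a - x.\<close>
  define A C :: "real poly" where "A = [:a, -a:]" and "C = [:0, a - 1:]"
  \<comment> \<open>Normalises the jump at \<open>a\<close>: the \<open>m\<close>-th derivative of
    \<open>U - V\<close> is \<open>- c * fact m\<close>, that is (-1)^(r-1).\<close>
  define c :: real where "c = (- 1) ^ r / fact m"
  define summand where "summand i = smult (real (m choose i)) (A ^ i * C ^ (m - i))" for i
  \<comment> \<open>For \<open>i < r\<close> the exponent \<open>m - i\<close> of \<open>C\<close>
    is at least \<open>r\<close>, giving the zero at 0; for \<open>i \<ge> r\<close> the power of
    \<open>A\<close> gives the zero at 1. The opposite signs make \<open>U - V\<close> the full
    binomial expansion.\<close>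
  define U where "U = smult c (\<Sum>i<r. summand i)"
  define V where "V = smult (- c) (\<Sum>i\<in>{r..m}. summand i)"
  have rm: "r \<le> m" "m = Suc (2 * (r - 1))" using r by (auto simp: m_def)
  have "U - V = smult c ((\<Sum>i<r. summand i) + (\<Sum>i\<in>{r..m}. summand i))"
    by (simp add: U_def V_def smult_add_right)
  also have "(\<Sum>i<r. summand i) + (\<Sum>i\<in>{r..m}. summand i) = (\<Sum>i\<le>m. summand i)"
  proof -
    have "{..m} = {..<r} \<union> {r..m}" using rm(1) by auto
    then show ?thesis by (simp add: sum.union_disjoint ivl_disj_int)
  qed
  also have "\<dots> = (A + C) ^ m"
    by (simp add: binomial_ring summand_def of_nat_poly mult.assoc)
  also have "A + C = smult (- 1) [:-a, 1:]"
    by (simp add: A_def C_def)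
  also have "\<dots> ^ m = smult (- 1) ([:-a, 1:] ^ m)"
  proof -
    have "(- 1 :: real) ^ m = - 1" by (subst rm(2)) simp
    then show ?thesis by (simp only: smult_power)
  qed
  finally have UV: "U - V = smult (- c) ([:-a, 1:] ^ m)" by simp
  have deg: "degree (summand i) < 2 * r" if "i \<le> m" for i
  proof -
    have "degree A \<le> 1" "degree C \<le> 1" by (simp_all add: A_def C_def)
    then have "degree (A ^ i) \<le> i" "degree (C ^ (m - i)) \<le> m - i"
      using degree_power_le[of A i] degree_power_le[of C "m - i"]
      by (metis (no_types) le_trans mult.commute mult_1_right mult_le_mono1)+
    then have "degree (A ^ i * C ^ (m - i)) \<le> m"
      using degree_mult_le[of "A ^ i" "C ^ (m - i)"] that by linarith
    then show ?thesis
      using degree_smult_le[of "real (m choose i)" "A ^ i * C ^ (m - i)"] r by (simp add: summand_def m_def)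
  qed
  have "extremal_spline r 0 a U V"
    unfolding extremal_spline_def
  proof (intro conjI allI impI)
    have "(pderiv ^^ (2 * r)) (summand i) = 0" if "i \<le> m" for i
      by (rule higher_pderiv_eq_0[OF deg[OF that]])
    then show "(pderiv ^^ (2 * r)) U = 0" "(pderiv ^^ (2 * r)) V = 0"
      unfolding U_def V_def higher_pderiv_smult higher_pderiv_sum using rm(1) by simp_all
  next
    fix i assume i: "i < r"
    have "[:- 0, 1:] ^ r dvd summand j" if "j < r" for j
    proof -
      have "[:- 0, 1:] ^ r dvd C ^ (m - j)"
      proof (rule dvd_power_le)
        have "C = [:- 0, 1:] * [:a - 1:]" by (simp add: C_def)
        then show "[:- 0, 1:] dvd C" by (rule dvdI)
      qed (use that in \<open>simp add: m_def\<close>)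
      then show ?thesis by (simp add: summand_def dvd_smult)
    qed
    then have "[:- 0, 1:] ^ r dvd U" by (auto simp: U_def intro!: dvd_smult dvd_sum)
    then show "poly ((pderiv ^^ i) U) 0 = 0" using i by (rule poly_higher_pderiv_eq_0)
    have "[:- 1, 1:] ^ r dvd summand j" if "r \<le> j" for j
    proof -
      have "[:- 1, 1:] ^ r dvd A ^ j"
      proof (rule dvd_power_le)
        have "A = [:- 1, 1:] * [:- a:]" by (simp add: A_def)
        then show "[:- 1, 1:] dvd A" by (rule dvdI)
      qed (use that in simp)
      then show ?thesis by (simp add: summand_def dvd_smult)
    qed
    then have "[:- 1, 1:] ^ r dvd V" unfolding V_def by (auto intro!: dvd_smult dvd_sum)
    then show "poly ((pderiv ^^ i) V) 1 = 0" using i by (rule poly_higher_pderiv_eq_0)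
  next
    fix i
    have "(pderiv ^^ i) U = (pderiv ^^ i) V + (pderiv ^^ i) (U - V)"
      by (simp flip: higher_pderiv_add)
    moreover have "(pderiv ^^ i) (U - V) = smult (- c) ((pderiv ^^ i) ([:-a, 1:] ^ m))"
      by (simp only: UV higher_pderiv_smult)
    ultimately have "poly ((pderiv ^^ i) U) a - poly ((pderiv ^^ i) V) a = - c * (if i = m then fact m else 0)"
      by (simp add: poly_higher_pderiv_linear_power)
    moreover have "- c * fact m = (- 1) ^ (r - 1)"
      using r by (cases r) (simp_all add: c_def)
    ultimately show "poly ((pderiv ^^ i) U) a - poly ((pderiv ^^ i) V) a =
       (if i = 2 * r - 1 - 0 then (- 1) ^ (r - 1 - 0) else 0)"
      by (simp add: m_def)
  qed
  moreover have "poly U a = - ((a\<^sup>2 - a) ^ (2 * r - 1) / ((2 * real r - 1) * (fact (r - 1))\<^sup>2))"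
  proof -
    obtain s where s: "r = Suc s" using r gr0_conv_Suc by blast
    have ms: "m = Suc (2 * s)" by (simp add: m_def s)
    have "poly (summand i) a = (- 1) ^ i * real (m choose i) * (a\<^sup>2 - a) ^ m" if "i \<le> m" for i
    proof -
      \<comment> \<open>At the knot the two linear factors are opposite, so every summand is a
        signed binomial coefficient times the same power.\<close>
      have "poly A a = - 1 * (a\<^sup>2 - a)" "poly C a = a\<^sup>2 - a"
        by (simp_all add: A_def C_def power2_eq_square algebra_simps)
      then have "poly (summand i) a = real (m choose i) * ((- 1 * (a\<^sup>2 - a)) ^ i * (a\<^sup>2 - a) ^ (m - i))"
        by (simp add: summand_def)
      also have "\<dots> = real (m choose i) * ((- 1) ^ i * ((a\<^sup>2 - a) ^ i * (a\<^sup>2 - a) ^ (m - i)))"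
        by (simp only: power_mult_distrib mult.assoc)
      also have "(a\<^sup>2 - a) ^ i * (a\<^sup>2 - a) ^ (m - i) = (a\<^sup>2 - a) ^ m"
        using that by (simp flip: power_add)
      finally show ?thesis by (simp add: mult.assoc)
    qed
    then have "poly U a = c * (\<Sum>i\<le>s. (- 1) ^ i * real (m choose i) * (a\<^sup>2 - a) ^ m)"
      using ms by (simp add: U_def poly_sum s lessThan_Suc_atMost)
    also have "\<dots> = c * ((\<Sum>i\<le>s. (- 1) ^ i * real (m choose i)) * (a\<^sup>2 - a) ^ m)"
      by (simp only: sum_distrib_right)
    also have "(\<Sum>i\<le>s. (- 1) ^ i * real (m choose i)) = (- 1) ^ s * (fact (2 * s) / (fact s * fact s))"
      unfolding ms alternating_binomial_partial_sum by (simp add: binomial_fact mult_2)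
    also have "c * ((- 1) ^ s * (fact (2 * s) / (fact s * fact s)) * (a\<^sup>2 - a) ^ m) =
        - ((a\<^sup>2 - a) ^ m * fact (2 * s) / (fact m * (fact s)\<^sup>2))"
      by (simp add: c_def s power2_eq_square)
    also have "fact m = (2 * real s + 1) * fact (2 * s)"
      unfolding ms by simp
    finally show ?thesis
      by (simp add: s ms m_def)
  qed
  ultimately show thesis by (rule that)
qed

subsection \<open>The case \<open>k = 5\<close>\<close>

text \<open>These are the derivatives at \<open>a\<close> entering the five corrections. With
  exponent \<open>r + j\<close> each contains the factor \<open>t ^ r\<close>; \<open>s\<close> is
  the first derivative of \<open>tau\<close> at \<open>a\<close>.\<close>

lemma poly_higher_pderiv_tau_power:
  fixes a :: real
  defines "t \<equiv> a\<^sup>2 - a" and "s \<equiv> 2 * a - 1"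
  shows "poly ((pderiv ^^ 0) (tau ^ r)) a = t ^ r"
    and "poly ((pderiv ^^ 1) (tau ^ (r + 1))) a = (real r + 1) * t ^ r * s"
    and "poly ((pderiv ^^ 2) (tau ^ (r + 2))) a = (real r + 2) * t ^ r * ((real r + 1) * s ^ 2 + 2 * t)"
    and "poly ((pderiv ^^ 3) (tau ^ (r + 3))) a =
      (real r + 3) * (real r + 2) * t ^ r * s * ((real r + 1) * s ^ 2 + 6 * t)"
    and "poly ((pderiv ^^ 4) (tau ^ (r + 4))) a =
      (real r + 4) * (real r + 3) * t ^ r * ((real r + 2) * (real r + 1) * s ^ 4 + 12 * (real r + 2) * t * s ^ 2 + 12 * t ^ 2)"
proof -
  define \<sigma> :: "real poly" where "\<sigma> = [:-1, 2:]"
  have ev: "poly tau a = t" "poly \<sigma> a = s"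
    by (simp_all add: t_def s_def \<sigma>_def power2_eq_square algebra_simps)
  have d\<sigma>: "pderiv \<sigma> = [:2:]" by (simp add: \<sigma>_def pderiv_pCons)
  \<comment> \<open>Naming \<open>tau\<close> keeps its coefficient list out of the computation, so
    that powers are differentiated by the chain rule.\<close>
  define T where "T = tau"
  have dT: "pderiv T = \<sigma>" by (simp add: T_def \<sigma>_def pderiv_pCons)
  have evT: "poly T a = t" using ev by (simp add: T_def)
  show "poly ((pderiv ^^ 0) (tau ^ r)) a = t ^ r"
    unfolding T_def[symmetric] by (simp add: evT)
  show "poly ((pderiv ^^ 1) (tau ^ (r + 1))) a = (real r + 1) * t ^ r * s"
    unfolding T_def[symmetric] by (simp add: pderiv_power_Suc dT evT ev algebra_simps del: power_Suc)
  show "poly ((pderiv ^^ 2) (tau ^ (r + 2))) a = (real r + 2) * t ^ r * ((real r + 1) * s ^ 2 + 2 * t)"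
    unfolding T_def[symmetric]
    by (simp add: numeral_eq_Suc pderiv_power_Suc pderiv_mult pderiv_smult dT d\<sigma> evT ev(2) del: power_Suc)
       (simp add: algebra_simps)
  show "poly ((pderiv ^^ 3) (tau ^ (r + 3))) a =
      (real r + 3) * (real r + 2) * t ^ r * s * ((real r + 1) * s ^ 2 + 6 * t)"
    unfolding T_def[symmetric]
    by (simp add: numeral_eq_Suc pderiv_power_Suc pderiv_mult pderiv_smult pderiv_add dT d\<sigma> evT ev(2) del: power_Suc)
       (simp add: algebra_simps)
  show "poly ((pderiv ^^ 4) (tau ^ (r + 4))) a =
      (real r + 4) * (real r + 3) * t ^ r * ((real r + 2) * (real r + 1) * s ^ 4 + 12 * (real r + 2) * t * s ^ 2 + 12 * t ^ 2)"
    unfolding T_def[symmetric]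
    by (simp add: numeral_eq_Suc pderiv_power_Suc pderiv_mult pderiv_smult pderiv_add dT d\<sigma> evT ev(2) del: power_Suc)
       (simp add: algebra_simps)
qed

text \<open>The left side is the bracket of the final formula with n = R + 5. The right side
  collects the initial value and the five corrections over a common denominator, with
  \<open>S\<close> standing for (2a-1)^2.\<close>

lemma extremal_value_identity:
  fixes R t S :: real
  assumes "S = 4 * t + 1"
  shows "16 * (2 * R + 9) * (2 * R + 7)\<^sup>2 * (2 * R + 5)\<^sup>2 * (2 * R - 1) * t ^ 5
    + 80 * (R + 4) * (R + 2) * (2 * R + 7) * (2 * R + 5)\<^sup>2 * (2 * R - 1) * t ^ 4
    + 40 * (R + 3) * (R + 2) * (2 * R + 7) * (2 * R + 5) * (2 * R + 3) * (2 * R - 1) * t ^ 3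
    + 40 * (R + 3) * (R + 2)\<^sup>2 * (R + 1) * (2 * R + 5) * (2 * R - 1) * t ^ 2
    + 5 * (R + 2)\<^sup>2 * (R + 1)\<^sup>2 * (2 * R + 5) * (2 * R - 1) * t
    + (R + 2)\<^sup>2 * (R + 1)\<^sup>2 * R\<^sup>2
    = (R * (R + 1) * (R + 2))\<^sup>2 + (2 * R - 1) * t *
      ((2 * R + 1) * ((R + 1) * (R + 2))\<^sup>2 + (2 * R + 3) * ((R + 1) * (R + 2))\<^sup>2 * S
       + (2 * R + 5) * (R + 2)\<^sup>2 * ((R + 1) * S + 2 * t)\<^sup>2
       + (2 * R + 7) * (R + 2)\<^sup>2 * S * ((R + 1) * S + 6 * t)\<^sup>2
       + (2 * R + 9) * ((R + 2) * (R + 1) * S\<^sup>2 + 12 * (R + 2) * t * S + 12 * t\<^sup>2)\<^sup>2)"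
  unfolding assms by algebra

theorem mainTheorem6:
  fixes n :: nat and a t :: real
  assumes "n \<ge> 6" and "0 < a" and "a < 1" and "t = a\<^sup>2 - a"
  shows "(A_sup n 5 a)\<^sup>2 = ereal (
    (- (t ^ (2 * n - 11))) / ((fact (n - 3))\<^sup>2 * (2 * real n - 11)) *
    ( 16 * (2 * real n - 1) * (2 * real n - 3)\<^sup>2 * (2 * real n - 5)\<^sup>2 * (2 * real n - 11) * t ^ 5
    + 80 * (real n - 1) * (real n - 3) * (2 * real n - 3) * (2 * real n - 5)\<^sup>2 * (2 * real n - 11) * t ^ 4
    + 40 * (real n - 2) * (real n - 3) * (2 * real n - 3) * (2 * real n - 5) * (2 * real n - 7)
         * (2 * real n - 11) * t ^ 3
    + 40 * (real n - 2) * (real n - 3)\<^sup>2 * (real n - 4) * (2 * real n - 5) * (2 * real n - 11) * t ^ 2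
    + 5 * (real n - 3)\<^sup>2 * (real n - 4)\<^sup>2 * (2 * real n - 5) * (2 * real n - 11) * t
    + (real n - 3)\<^sup>2 * (real n - 4)\<^sup>2 * (real n - 5)\<^sup>2))"
proof -
  \<comment> \<open>The chain runs from \<open>(r, 0)\<close> to \<open>(r + 5, 5)\<close>;
    \<open>n \<ge> 6\<close> makes the starting order positive. Below, \<open>c j\<close> is the
    correction in the step from \<open>(r + j, j)\<close>.\<close>
  define r where "r = n - 5"
  have r: "0 < r" and nr: "n = Suc (Suc (Suc (Suc (Suc r))))" using assms(1) by (auto simp: r_def)
  define R where "R = real r"
  define D where "D j = poly ((pderiv ^^ j) (tau ^ (r + j))) a" for j
  define c where "c j = (2 * real (r + j) + 1) / (fact (r + j))\<^sup>2 * (D j)\<^sup>2" for j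
  obtain U0 V0 where base: "extremal_spline r 0 a U0 V0"
    "poly U0 a = - (t ^ (2 * r - 1) / ((2 * real r - 1) * (fact (r - 1))\<^sup>2))"
    using extremal_spline_0[OF r, of a] unfolding assms(4) by blast
  have "\<exists>U V. extremal_spline (r + j) j a U V \<and>
      poly ((pderiv ^^ j) U) a = - (t ^ (2 * r - 1) / ((2 * real r - 1) * (fact (r - 1))\<^sup>2)) - (\<Sum>i<j. c i)" for j
  proof (induction j)
    case 0
    then show ?case using base by (intro exI[of _ U0] exI[of _ V0]) simp
  next
    case (Suc j)
    then obtain U V where UV: "extremal_spline (r + j) j a U V"
      "poly ((pderiv ^^ j) U) a = - (t ^ (2 * r - 1) / ((2 * real r - 1) * (fact (r - 1))\<^sup>2)) - (\<Sum>i<j. c i)"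
      by blast
    obtain U' V' where "extremal_spline (Suc (r + j)) (Suc j) a U' V'"
      "poly ((pderiv ^^ Suc j) U') a = poly ((pderiv ^^ j) U) a - c j"
      using extremal_spline_Suc[OF UV(1)] r unfolding c_def D_def by (metis less_add_same_cancel2)
    then show ?case using UV(2) by (intro exI[of _ U'] exI[of _ V']) simp
  qed
  from this[of 5] obtain U V where UV: "extremal_spline n 5 a U V" and
    val: "poly ((pderiv ^^ 5) U) a = - (t ^ (2 * r - 1) / ((2 * R - 1) * (fact (r - 1))\<^sup>2)) - (\<Sum>i<5. c i)"
    by (auto simp: nr R_def add.commute numeral_eq_Suc)
  define f :: real where "f = fact (r - 1)"
  define s where "s = 2 * a - 1"
  define y where "y = t ^ (2 * r - 1)"
  \<comment> \<open>This is (r+2)!, hence the (n-3)! of the result. Its square serves as common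
    denominator.\<close>
  define F where "F = R * (R + 1) * (R + 2) * f"
  have R: "R \<ge> 1" using r by (simp add: R_def)
  have f: "f > 0" by (simp add: f_def)
  have F: "F > 0" using R f by (simp add: F_def)
  have s: "s\<^sup>2 = 4 * t + 1" by (simp add: s_def assms(4) power2_eq_square algebra_simps)
  \<comment> \<open>The initial value carries the exponent \<open>2 * r - 1\<close> and the
    corrections \<open>2 * r\<close>; this accounts for the extra factor \<open>t\<close> in front
    of \<open>Q\<close>.\<close>
  have y: "(t ^ r)\<^sup>2 = y * t"
  proof -
    have "r * 2 = Suc (2 * r - 1)" using r by simp
    then show ?thesis unfolding y_def power_mult[symmetric] by (metis power_Suc2)
  qed
  have fact0: "fact r = R * f" using r by (cases r) (simp_all add: f_def R_def)
  have fact1: "fact (r + 1) = (R + 1) * R * f" using fact0 by (simp add: R_def)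
  have fact2: "fact (r + 2) = F" using fact1 by (simp add: R_def F_def numeral_eq_Suc)
  have fact3: "fact (r + 3) = (R + 3) * F" using fact2 by (simp add: R_def numeral_eq_Suc)
  have fact4: "fact (r + 4) = (R + 4) * (R + 3) * F" using fact3 by (simp add: R_def numeral_eq_Suc)
  note D = poly_higher_pderiv_tau_power[of r a, folded assms(4) s_def R_def]
  have D0: "D 0 = t ^ r" and D1: "D 1 = (R + 1) * t ^ r * s"
    and D2: "D 2 = (R + 2) * t ^ r * ((R + 1) * s ^ 2 + 2 * t)"
    and D3: "D 3 = (R + 3) * (R + 2) * t ^ r * s * ((R + 1) * s ^ 2 + 6 * t)"
    and D4: "D 4 = (R + 4) * (R + 3) * t ^ r * ((R + 2) * (R + 1) * s ^ 4 + 12 * (R + 2) * t * s ^ 2 + 12 * t ^ 2)"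
    using D unfolding D_def by simp_all
  \<comment> \<open>Read backwards it enlarges the smaller factorials of \<open>c 0\<close> and
    \<open>c 1\<close> to \<open>F\<close>; read forwards it removes the excess factors in
    \<open>c 3\<close> and \<open>c 4\<close>.\<close>
  have cancel: "K / (g * h)\<^sup>2 * (g * q)\<^sup>2 = K / h\<^sup>2 * q\<^sup>2" if "g > 0" for K g h q :: real
    using that by (simp add: power_mult_distrib)
  have c0: "c 0 = y * t / F\<^sup>2 * ((2 * R + 1) * ((R + 1) * (R + 2))\<^sup>2)"
  proof -
    have "c 0 = (2 * R + 1) / (R * f)\<^sup>2 * (t ^ r)\<^sup>2"
      by (simp add: c_def D0 fact0 flip: R_def)
    also have "\<dots> = (2 * R + 1) / F\<^sup>2 * ((R + 1) * (R + 2) * t ^ r)\<^sup>2"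
      using cancel[of "(R + 1) * (R + 2)" "2 * R + 1" "R * f" "t ^ r"] R by (simp add: F_def mult_ac)
    finally show ?thesis by (simp add: power_mult_distrib y)
  qed
  have c1: "c 1 = y * t / F\<^sup>2 * ((2 * R + 3) * ((R + 1) * (R + 2))\<^sup>2 * s\<^sup>2)"
  proof -
    have "c 1 = (2 * R + 3) / ((R + 1) * R * f)\<^sup>2 * ((R + 1) * t ^ r * s)\<^sup>2"
      unfolding c_def D1 fact1 by (simp add: R_def)
    also have "\<dots> = (2 * R + 3) / F\<^sup>2 * ((R + 2) * ((R + 1) * t ^ r * s))\<^sup>2"
      using cancel[of "R + 2" "2 * R + 3" "(R + 1) * R * f" "(R + 1) * t ^ r * s"] R by (simp add: F_def mult_ac)
    finally show ?thesis by (simp add: power_mult_distrib y)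
  qed
  have c2: "c 2 = y * t / F\<^sup>2 * ((2 * R + 5) * (R + 2)\<^sup>2 * ((R + 1) * s\<^sup>2 + 2 * t)\<^sup>2)"
  proof -
    have "c 2 = (2 * R + 5) / F\<^sup>2 * ((R + 2) * t ^ r * ((R + 1) * s\<^sup>2 + 2 * t))\<^sup>2"
      unfolding c_def D2 fact2 by (simp add: R_def)
    then show ?thesis by (simp add: power_mult_distrib y)
  qed
  have c3: "c 3 = y * t / F\<^sup>2 * ((2 * R + 7) * (R + 2)\<^sup>2 * s\<^sup>2 * ((R + 1) * s\<^sup>2 + 6 * t)\<^sup>2)"
  proof -
    have "c 3 = (2 * R + 7) / ((R + 3) * F)\<^sup>2 * ((R + 3) * ((R + 2) * t ^ r * s * ((R + 1) * s\<^sup>2 + 6 * t)))\<^sup>2"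
      unfolding c_def D3 fact3 by (simp add: R_def mult.assoc)
    also have "\<dots> = (2 * R + 7) / F\<^sup>2 * ((R + 2) * t ^ r * s * ((R + 1) * s\<^sup>2 + 6 * t))\<^sup>2"
      by (rule cancel) (use R in simp)
    finally show ?thesis by (simp add: power_mult_distrib y)
  qed
  have c4: "c 4 = y * t / F\<^sup>2 * ((2 * R + 9) *
      ((R + 2) * (R + 1) * (s\<^sup>2)\<^sup>2 + 12 * (R + 2) * t * s\<^sup>2 + 12 * t\<^sup>2)\<^sup>2)"
  proof -
    define q where "q = (R + 2) * (R + 1) * (s\<^sup>2)\<^sup>2 + 12 * (R + 2) * t * s\<^sup>2 + 12 * t\<^sup>2"
    have "c 4 = (2 * R + 9) / ((R + 4) * (R + 3) * F)\<^sup>2 * ((R + 4) * (R + 3) * (t ^ r * q))\<^sup>2"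
      unfolding c_def D4 fact4 q_def by (simp add: R_def mult.assoc)
    also have "\<dots> = (2 * R + 9) / F\<^sup>2 * (t ^ r * q)\<^sup>2"
      by (rule cancel) (use R in simp)
    finally show ?thesis unfolding q_def[symmetric] by (simp add: power_mult_distrib y)
  qed
  define Q where "Q = (2 * R + 1) * ((R + 1) * (R + 2))\<^sup>2 + (2 * R + 3) * ((R + 1) * (R + 2))\<^sup>2 * s\<^sup>2
       + (2 * R + 5) * (R + 2)\<^sup>2 * ((R + 1) * s\<^sup>2 + 2 * t)\<^sup>2
       + (2 * R + 7) * (R + 2)\<^sup>2 * s\<^sup>2 * ((R + 1) * s\<^sup>2 + 6 * t)\<^sup>2
       + (2 * R + 9) * ((R + 2) * (R + 1) * (s\<^sup>2)\<^sup>2 + 12 * (R + 2) * t * s\<^sup>2 + 12 * t\<^sup>2)\<^sup>2"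
  have "(\<Sum>i<5. c i) = c 0 + c 1 + c 2 + c 3 + c 4"
    by (simp add: eval_nat_numeral)
  also have "\<dots> = y * t / F\<^sup>2 * Q"
    unfolding c0 c1 c2 c3 c4 Q_def distrib_left ..
  finally have "poly ((pderiv ^^ 5) U) a = - (y / ((2 * R - 1) * f\<^sup>2)) - y * t / F\<^sup>2 * Q"
    using val by (simp only: y_def f_def)
  also have "y / ((2 * R - 1) * f\<^sup>2) = y * (R * (R + 1) * (R + 2))\<^sup>2 / (F\<^sup>2 * (2 * R - 1))"
  proof -
    have "R * (R + 1) * (R + 2) \<noteq> 0" using R by auto
    then show ?thesis unfolding F_def power_mult_distrib[of _ f] by (simp add: mult_ac)
  qed
  also have "- (y * (R * (R + 1) * (R + 2))\<^sup>2 / (F\<^sup>2 * (2 * R - 1))) - y * t / F\<^sup>2 * Q =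
      - y / (F\<^sup>2 * (2 * R - 1)) * ((R * (R + 1) * (R + 2))\<^sup>2 + (2 * R - 1) * t * Q)"
    using R F by (simp add: field_simps)
  \<comment> \<open>Applied with \<open>S\<close> equal to \<open>s\<^sup>2\<close>, which is where
    4t + 1 = (2a-1)^2 is used.\<close>
  also note extremal_value_identity[OF s, of R, folded Q_def, symmetric]
  also note final = calculation
  have "real n = R + 5" by (simp add: nr R_def)
  then have coeffs: "2 * real n - 1 = 2 * R + 9" "2 * real n - 3 = 2 * R + 7" "2 * real n - 5 = 2 * R + 5"
    "2 * real n - 7 = 2 * R + 3" "2 * real n - 11 = 2 * R - 1" "real n - 1 = R + 4" "real n - 2 = R + 3"
    "real n - 3 = R + 2" "real n - 4 = R + 1" "real n - 5 = R" by simp_all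
  have nats: "n - 3 = r + 2" "2 * n - 11 = 2 * r - 1" by (simp_all add: nr)
  have "5 < n" using assms(1) by simp
  from A_sup_extremal_spline[OF this assms(2,3) UV] show ?thesis
    unfolding final coeffs nats fact2 y_def .
qed

end
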